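(* Let $b_+,b_->0$, $\delta_\pm\in\mathbb R$ with $b_\pm+\delta_\pm>0$ and $\delta_+\delta_-<0$, and $c>0$. Then there is a nonzero real constant $E^{(1)}_{\mathrm{II}}$, determined by $(b_\pm,\delta_\pm,c)$, such that for all sufficiently small but nonzero $|k|$ the type-II interface Hamiltonian $\hat H_{\mathrm{II}}(k)$ (defined in the context) has two distinct eigenvalues $E_{\mathrm{II},+}(k)$, $E_{\mathrm{II},-}(k)$ satisfying $$E_{\mathrm{II},\pm}(k)=\pm E^{(1)}_{\mathrm{II}}|k|+\mathcal O(k^2).$$
   Context: Coefficients: for $n\in\mathbb Z$ let $b_n=b_+$ for $n\ge0$ and $b_n=b_-$ for $n\le-1$; $c_n=b_++\delta_+$ for $n\ge0$, $c_{-1}=c$, $c_n=b_-+\delta_-$ for $n\le-2$; $d_n=b_++\delta_+$ for $n\ge0$, $d_{-1}=d_{-2}=c$, $d_n=b_-+\delta_-$ for $n\le-3$. For $k\in[-\pi,\pi)$, $\hat H_{\mathrm{II}}(k)$ is the bounded self-adjoint operator on $\ell^2(\mathbb Z;\mathbb C^6)$ acting on $w=\{(w_{j,n})_{j=1}^6\}_{n\in\mathbb Z}$ by $(\hat H_{\mathrm{II}}(k)w)_{1,n}=-b_nw_{4,n}-b_nw_{5,n}-c_ne^{-ik}w_{6,n+1}$, $(\hat H_{\mathrm{II}}(k)w)_{2,n}=-b_nw_{4,n}-d_{n-2}e^{ik}w_{5,n-2}-b_nw_{6,n}$, $(\hat H_{\mathrm{II}}(k)w)_{3,n}=-c_nw_{4,n+1}-b_nw_{5,n}-b_nw_{6,n}$,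 $(\hat H_{\mathrm{II}}(k)w)_{4,n}=-b_nw_{1,n}-b_nw_{2,n}-c_{n-1}w_{3,n-1}$, $(\hat H_{\mathrm{II}}(k)w)_{5,n}=-b_nw_{1,n}-d_ne^{-ik}w_{2,n+2}-b_nw_{3,n}$, $(\hat H_{\mathrm{II}}(k)w)_{6,n}=-c_{n-1}e^{ik}w_{1,n-1}-b_nw_{2,n}-b_nw_{3,n}$. *)

theory Defs
  imports "HOL-Analysis.Analysis"
begin

definition coef_b :: "real \<Rightarrow> real \<Rightarrow> int \<Rightarrow> complex" where
  "coef_b bp bm n = complex_of_real (if n \<ge> 0 then bp else bm)"

definition coef_c :: "real \<Rightarrow> real \<Rightarrow> real \<Rightarrow> real \<Rightarrow> real \<Rightarrow> int \<Rightarrow> complex" where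
  "coef_c bp bm dp dm cc n = complex_of_real
     (if n \<ge> 0 then bp + dp else if n = -1 then cc else bm + dm)"

definition coef_d :: "real \<Rightarrow> real \<Rightarrow> real \<Rightarrow> real \<Rightarrow> real \<Rightarrow> int \<Rightarrow> complex" where
  "coef_d bp bm dp dm cc n = complex_of_real
     (if n \<ge> 0 then bp + dp else if n = -1 \<or> n = -2 then cc else bm + dm)"

text \<open>Action of the type-II interface Hamiltonian \<open>\<hat>H_II(k)\<close> on a sequence
  w :: int \<Rightarrow> nat \<Rightarrow> complex, where w n j is the component w_{j,n}, j \<in> {1..6}.
  The result (H w) n j is the j-th component at site n.\<close>

definition H_II :: "real \<Rightarrow> real \<Rightarrow> real \<Rightarrow> real \<Rightarrow> real \<Rightarrow> real \<Rightarrow>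
    (int \<Rightarrow> nat \<Rightarrow> complex) \<Rightarrow> int \<Rightarrow> nat \<Rightarrow> complex" where
  "H_II bp bm dp dm cc k w n j =
    (let b = coef_b bp bm; c = coef_c bp bm dp dm cc; d = coef_d bp bm dp dm cc;
         ep = exp (\<i> * complex_of_real k); em = exp (- \<i> * complex_of_real k) in
     if j = 1 then - b n * w n 4 - b n * w n 5 - c n * em * w (n+1) 6
     else if j = 2 then - b n * w n 4 - d (n-2) * ep * w (n-2) 5 - b n * w n 6
     else if j = 3 then - c n * w (n+1) 4 - b n * w n 5 - b n * w n 6
     else if j = 4 then - b n * w n 1 - b n * w n 2 - c (n-1) * w (n-1) 3
     else if j = 5 then - b n * w n 1 - d n * em * w (n+2) 2 - b n * w n 3
     else if j = 6 then - c (n-1) * ep * w (n-1) 1 - b n * w n 2 - b n * w n 3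
     else 0)"

definition l2_C6 :: "(int \<Rightarrow> nat \<Rightarrow> complex) \<Rightarrow> bool" where
  "l2_C6 w \<longleftrightarrow> (\<lambda>n. \<Sum>j\<in>{1..6}. (cmod (w n j))\<^sup>2) summable_on (UNIV :: int set)"

definition is_eigenvalue_H_II :: "real \<Rightarrow> real \<Rightarrow> real \<Rightarrow> real \<Rightarrow> real \<Rightarrow> real \<Rightarrow> real \<Rightarrow> bool" where
  "is_eigenvalue_H_II bp bm dp dm cc k E \<longleftrightarrow>
     (\<exists>w. l2_C6 w \<and> (\<exists>n. \<exists>j\<in>{1..6}. w n j \<noteq> 0) \<and>
          (\<forall>n. \<forall>j\<in>{1..6}. H_II bp bm dp dm cc k w n j = complex_of_real E * w n j))"

end

theory Submission
  imports Defs "HOL-Probability.Discrete_Topology" "HOL-Real_Asymp.Real_Asymp"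
begin

text \<open>By the reflection \<open>n \<mapsto> -1 - n\<close> we may assume \<open>\<delta>\<^sub>+ > 0 > \<delta>\<^sub>-\<close>. The Hamiltonian is chiral,
  and in the gauge \<open>e\<^bsup>i\<kappa>n\<^esup>\<close>, \<open>\<kappa> = k / 2\<close>, it becomes a real operator. At \<open>k = 0\<close> it splits under
  the exchange \<open>1 \<leftrightarrow> 3\<close>, \<open>4 \<leftrightarrow> 6\<close>: one sublattice carries an odd zero mode and the other an even
  one, both positive and exponentially localized. They are coupled at first order in \<open>\<kappa>\<close>, and
  the coupling does not vanish because it is an overlap of positive sequences; hence the double
  eigenvalue \<open>0\<close> splits linearly. The splitting is made rigorous by a Lyapunov-Schmidt fixed
  point argument in a space of exponentially decaying sequences, where the unperturbed operator
  is inverted, up to the zero modes, by explicit Green kernels of its first-order factors.\<close>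

section \<open>Splitting of a double eigenvalue\<close>

lemma small_perturbation_fixed_point:
  fixes W :: "'a::banach \<Rightarrow> 'a"
  assumes a_bound: "norm a \<le> B"
    and lip: "L-lipschitz_on (cball 0 (B + 1)) W"
    and W_0: "norm (W 0) \<le> M"
    and small: "\<bar>\<kappa>\<bar> * (M + L * (B + 1)) \<le> 1" "\<bar>\<kappa>\<bar> * L < 1"
  obtains x where "norm x \<le> B + 1" "a + \<kappa> *\<^sub>R W x = x"
proof -
  have "0 \<le> B" using a_bound norm_ge_zero[of a] by linarith
  have bound: "norm (W x) \<le> M + L * (B + 1)" if "norm x \<le> B + 1" for x
  proof -
    have "norm (W x - W 0) \<le> L * norm (x - 0)"
      using \<open>0 \<le> B\<close> that by (intro lipschitz_on_normD[OF lip]) auto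
    also have "\<dots> \<le> L * (B + 1)" using that lipschitz_on_nonneg[OF lip] by (simp add: mult_left_mono)
    finally show ?thesis using W_0 norm_triangle_sub[of "W x" "W 0"] by linarith
  qed
  have "\<exists>!x\<in>cball 0 (B + 1). a + \<kappa> *\<^sub>R W x = x"
  proof (rule Banach_fix[OF _ _ _ small(2)])
    show "complete (cball 0 (B + 1) :: 'a set)" by (simp add: complete_eq_closed)
    show "cball 0 (B + 1) \<noteq> ({} :: 'a set)" using \<open>0 \<le> B\<close> by simp
    show "0 \<le> \<bar>\<kappa>\<bar> * L" using lipschitz_on_nonneg[OF lip] by simp
    show "(\<lambda>x. a + \<kappa> *\<^sub>R W x) ` cball 0 (B + 1) \<subseteq> cball 0 (B + 1)"
    proof clarsimp
      fix x :: 'a assume "norm x \<le> B + 1"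
      then have "\<bar>\<kappa>\<bar> * norm (W x) \<le> \<bar>\<kappa>\<bar> * (M + L * (B + 1))" by (intro mult_left_mono bound) auto
      then show "norm (a + \<kappa> *\<^sub>R W x) \<le> B + 1"
        using a_bound small(1) norm_triangle_ineq[of a "\<kappa> *\<^sub>R W x"] by simp
    qed
    have "(0 + \<bar>\<kappa>\<bar> * L)-lipschitz_on (cball 0 (B + 1)) (\<lambda>x. a + \<kappa> *\<^sub>R W x)"
      by (intro lipschitz_intros lip)
    then show "dist (a + \<kappa> *\<^sub>R W x) (a + \<kappa> *\<^sub>R W y) \<le> \<bar>\<kappa>\<bar> * L * dist x y"
      if "x \<in> cball 0 (B + 1)" "y \<in> cball 0 (B + 1)" for x y
      using lipschitz_onD(1) that by fastforce
  qed
  then show ?thesis using that by auto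
qed

lemma lipschitz_on_scaleR:
  fixes f :: "'a::metric_space \<Rightarrow> real" and g :: "'a \<Rightarrow> 'b::real_normed_vector"
  assumes lip_f: "L-lipschitz_on X f" "\<And>x. x \<in> X \<Longrightarrow> \<bar>f x\<bar> \<le> A" and "0 \<le> A"
    and lip_g: "M-lipschitz_on X g" "\<And>x. x \<in> X \<Longrightarrow> norm (g x) \<le> B" and "0 \<le> B"
  shows "(A * M + L * B)-lipschitz_on X (\<lambda>x. f x *\<^sub>R g x)"
proof (rule lipschitz_onI)
  note nonneg = lipschitz_on_nonneg[OF lip_f(1)] lipschitz_on_nonneg[OF lip_g(1)]
  show "0 \<le> A * M + L * B" using nonneg assms by simp
  fix x y assume x_mem: "x \<in> X" and y_mem: "y \<in> X"
  have "dist (f x *\<^sub>R g x) (f y *\<^sub>R g y) = norm (f x *\<^sub>R (g x - g y) + (f x - f y) *\<^sub>R g y)"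
    by (simp add: dist_norm algebra_simps)
  also have "\<dots> \<le> \<bar>f x\<bar> * dist (g x) (g y) + dist (f x) (f y) * norm (g y)"
    by (metis dist_norm norm_scaleR norm_triangle_ineq real_norm_def)
  also have "\<dots> \<le> A * (M * dist x y) + (L * dist x y) * B"
    using nonneg assms x_mem y_mem
    by (intro add_mono mult_mono lipschitz_onD(1)[OF lip_f(1)] lipschitz_onD(1)[OF lip_g(1)]) auto
  finally show "dist (f x *\<^sub>R g x) (f y *\<^sub>R g y) \<le> (A * M + L * B) * dist x y"
    by (simp add: algebra_simps)
qed

lemma lipschitz_on_blinfun:
  fixes T :: "'b::real_normed_vector \<Rightarrow>\<^sub>L 'c::real_normed_vector"
  assumes lip_f: "L-lipschitz_on X f" and T_bound: "norm T \<le> K"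
  shows "(K * L)-lipschitz_on X (\<lambda>x. T (f x))"
proof (rule lipschitz_onI)
  have "0 \<le> K" using T_bound norm_ge_zero[of T] by linarith
  then show "0 \<le> K * L" using lipschitz_on_nonneg[OF lip_f] by simp
  fix x y assume "x \<in> X" "y \<in> X"
  have "dist (T (f x)) (T (f y)) \<le> norm T * dist (f x) (f y)"
    using norm_blinfun[of T "f x - f y"] by (simp add: dist_norm blinfun.diff_right)
  also have "\<dots> \<le> K * (L * dist x y)"
    using T_bound \<open>0 \<le> K\<close> \<open>x \<in> X\<close> \<open>y \<in> X\<close> by (intro mult_mono lipschitz_onD(1)[OF lip_f]) auto
  finally show "dist (T (f x)) (T (f y)) \<le> K * L * dist x y" by (simp add: mult.assoc)
qed

lemma eventually_abs_mult_less:
  fixes a c :: real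
  assumes "0 < a"
  shows "\<forall>\<^sub>F \<kappa> in at 0. \<bar>\<kappa>\<bar> * c < a"
  by (rule order_tendstoD(2)[where y = 0]) (use assms in \<open>auto intro!: tendsto_eq_intros\<close>)

text \<open>The eigenvalue \<open>0\<close> of \<open>T0\<close> has the eigenvectors \<open>z0\<close> and \<open>z1\<close>, and the functionals \<open>\<phi>\<close> and
  \<open>\<psi>\<close> vanish on the range of \<open>T0\<close>. The assumptions say that \<open>\<eta>0\<close> is a simple eigenvalue of the
  reduced two-dimensional problem with the right eigenvector \<open>z0\<close> and the left eigenvector \<open>\<phi>\<close>.\<close>

locale double_eigenvalue =
  fixes T0 T1 G :: "'a::banach \<Rightarrow>\<^sub>L 'a" and \<phi> \<psi> :: "'a \<Rightarrow>\<^sub>L real" and z0 z1 :: 'a and \<eta>0 :: real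
  assumes T0_z0: "T0 z0 = 0" and T0_z1: "T0 z1 = 0"
    and T0_G: "\<And>h. \<phi> h = 0 \<Longrightarrow> \<psi> h = 0 \<Longrightarrow> T0 (G h) = h"
    and \<phi>_z0: "\<phi> z0 \<noteq> 0" and \<psi>_z0: "\<psi> z0 = 0"
    and \<phi>_T1_z0: "\<phi> (T1 z0) = \<eta>0 * \<phi> z0" and \<psi>_T1_z0: "\<psi> (T1 z0) = 0"
    and \<phi>_T1_z1: "\<phi> (T1 z1) = \<eta>0 * \<phi> z1" and \<psi>_T1_z1: "\<psi> (T1 z1) \<noteq> \<eta>0 * \<psi> z1"
begin

definition first_order :: "'a \<Rightarrow>\<^sub>L 'a" where
  "first_order = T1 - \<eta>0 *\<^sub>R id_blinfun"

definition second_order :: "('a \<Rightarrow>\<^sub>L 'a) \<Rightarrow> 'a \<times> real \<Rightarrow> 'a" where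
  "second_order S u = S (fst u) - snd u *\<^sub>R fst u"

definition remainder :: "real \<Rightarrow> ('a \<Rightarrow>\<^sub>L 'a) \<Rightarrow> 'a \<times> real \<Rightarrow> 'a" where
  "remainder \<kappa> S u = first_order (fst u) - snd u *\<^sub>R z0 + S z0 + \<kappa> *\<^sub>R second_order S u"

definition correction :: "'a \<Rightarrow>\<^sub>L ('a \<times> real)" where
  "correction = Blinfun (\<lambda>t. (- (\<psi> t / \<psi> (first_order z1)) *\<^sub>R z1, \<phi> t / \<phi> z0))"

lemma first_order_apply: "first_order v = T1 v - \<eta>0 *\<^sub>R v"
  by (simp add: first_order_def blinfun.diff_left blinfun.scaleR_left)

lemma correction_apply: "correction t = (- (\<psi> t / \<psi> (first_order z1)) *\<^sub>R z1, \<phi> t / \<phi> z0)"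
proof -
  have "bounded_linear (\<lambda>t. (- (\<psi> t / \<psi> (first_order z1)) *\<^sub>R z1, \<phi> t / \<phi> z0))"
    unfolding divide_inverse
    by (intro bounded_linear_intros bounded_linear_minus)
  then show ?thesis by (simp add: correction_def bounded_linear_Blinfun_apply)
qed

lemma reduced_problem:
  "\<phi> (first_order z0) = 0" "\<psi> (first_order z0) = 0" "\<phi> (first_order z1) = 0"
    "\<psi> (first_order z1) \<noteq> 0"
  using \<phi>_T1_z0 \<psi>_T1_z0 \<phi>_T1_z1 \<psi>_T1_z1 \<psi>_z0
  by (simp_all add: first_order_apply blinfun.bilinear_simps)

lemma ansatz_expansion:
  fixes S :: "'a \<Rightarrow>\<^sub>L 'a"
  shows "(T0 + \<kappa> *\<^sub>R T1 + \<kappa>\<^sup>2 *\<^sub>R S) (z0 + \<kappa> *\<^sub>R v) - (\<kappa> * (\<eta>0 + \<kappa> * e)) *\<^sub>R (z0 + \<kappa> *\<^sub>R v)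
    = \<kappa> *\<^sub>R (T0 v + (first_order z0 + \<kappa> *\<^sub>R remainder \<kappa> S (v, e)))"
  by (simp add: first_order_apply remainder_def second_order_def T0_z0 blinfun.bilinear_simps
    power2_eq_square algebra_simps)

lemma correction_solvable:
  fixes S :: "'a \<Rightarrow>\<^sub>L 'a"
  assumes "(v, e) = (x, 0) + correction (first_order x + S z0 + \<kappa> *\<^sub>R second_order S (v, e))"
  shows "\<phi> (remainder \<kappa> S (v, e)) = 0" "\<psi> (remainder \<kappa> S (v, e)) = 0" "T0 v = T0 x"
proof -
  define t where "t = first_order x + S z0 + \<kappa> *\<^sub>R second_order S (v, e)"
  have v_eq: "v = x - (\<psi> t / \<psi> (first_order z1)) *\<^sub>R z1" and e_eq: "e = \<phi> t / \<phi> z0"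
    using assms unfolding t_def[symmetric] correction_apply by auto
  have "remainder \<kappa> S (v, e)
      = t - (\<psi> t / \<psi> (first_order z1)) *\<^sub>R first_order z1 - (\<phi> t / \<phi> z0) *\<^sub>R z0"
    unfolding remainder_def t_def[symmetric] fst_conv snd_conv
    by (subst v_eq, subst e_eq) (simp add: t_def blinfun.bilinear_simps)
  then show "\<phi> (remainder \<kappa> S (v, e)) = 0" "\<psi> (remainder \<kappa> S (v, e)) = 0"
    using reduced_problem \<phi>_z0 \<psi>_z0 by (simp_all add: blinfun.bilinear_simps)
  show "T0 v = T0 x" by (simp add: v_eq T0_z1 blinfun.bilinear_simps)
qed

text \<open>The two solvability conditions at order \<open>\<kappa>\<^sup>2\<close> determine the second-order eigenvalue and
  the first-order coefficient of \<open>z1\<close>, so that the ansatz is a fixed point of \<open>u \<mapsto> a + \<kappa> W u\<close>.\<close>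

definition leading_part :: "('a \<Rightarrow>\<^sub>L 'a) \<Rightarrow> 'a \<times> real" where
  "leading_part S
      = (- G (first_order z0), 0) + correction (S z0 - first_order (G (first_order z0)))"

definition ansatz_map :: "real \<Rightarrow> ('a \<Rightarrow>\<^sub>L 'a) \<Rightarrow> 'a \<times> real \<Rightarrow> 'a \<times> real" where
  "ansatz_map \<kappa> S u = (- G (remainder \<kappa> S u), 0)
      + correction (second_order S u - first_order (G (remainder \<kappa> S u)))"

lemma fixed_point_eigenvector:
  fixes S :: "'a \<Rightarrow>\<^sub>L 'a"
  assumes "leading_part S + \<kappa> *\<^sub>R ansatz_map \<kappa> S (v, e) = (v, e)"
  shows "(T0 + \<kappa> *\<^sub>R T1 + \<kappa>\<^sup>2 *\<^sub>R S) (z0 + \<kappa> *\<^sub>R v) = (\<kappa> * (\<eta>0 + \<kappa> * e)) *\<^sub>R (z0 + \<kappa> *\<^sub>R v)"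
proof -
  define h where "h = first_order z0 + \<kappa> *\<^sub>R remainder \<kappa> S (v, e)"
  define x where "x = - G h"
  have "leading_part S + \<kappa> *\<^sub>R ansatz_map \<kappa> S (v, e)
      = (x, 0) + correction (first_order x + S z0 + \<kappa> *\<^sub>R second_order S (v, e))"
    by (simp add: leading_part_def ansatz_map_def x_def h_def prod_eq_iff scaleR_right_distrib
        scaleR_right_diff_distrib blinfun.bilinear_simps)
  note solvable = correction_solvable[OF this[unfolded assms]]
  have "\<phi> h = 0" "\<psi> h = 0"
    using reduced_problem solvable by (simp_all add: h_def blinfun.bilinear_simps)
  then have "T0 v + h = 0" using solvable(3) T0_G[of h] by (simp add: x_def blinfun.bilinear_simps)
  then show ?thesis using ansatz_expansion[of \<kappa> S v e] by (simp add: h_def)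
qed

lemma lipschitz_on_ansatz_map:
  assumes r_nonneg: "0 \<le> r"
  obtains L where "\<And>\<kappa> S. \<bar>\<kappa>\<bar> \<le> 1 \<Longrightarrow> norm S \<le> K \<Longrightarrow> L-lipschitz_on (cball 0 r) (ansatz_map \<kappa> S)"
proof
  fix \<kappa> :: real and S :: "'a \<Rightarrow>\<^sub>L 'a"
  assume \<kappa>_le_1: "\<bar>\<kappa>\<bar> \<le> 1" and S_le: "norm S \<le> K"
  let ?X = "cball 0 r :: ('a \<times> real) set"
  have fst: "1-lipschitz_on ?X fst" and snd: "1-lipschitz_on ?X snd"
    by (rule lipschitz_onI; simp add: dist_fst_le dist_snd_le)+
  have bounds: "norm (fst u) \<le> r" "\<bar>snd u\<bar> \<le> r" if "u \<in> ?X" for u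
    using that norm_fst_le[of "fst u" "snd u"] norm_snd_le[of "snd u" "fst u"] by auto
  define L2 where "L2 = K * 1 + (r * 1 + 1 * r)"
  have second_order: "L2-lipschitz_on ?X (second_order S)"
    unfolding second_order_def L2_def
    by (intro lipschitz_on_diff lipschitz_on_blinfun[OF fst S_le] lipschitz_on_scaleR fst snd bounds
      r_nonneg)
  define L1 where "L1 = norm first_order * 1 + (r * 0 + 1 * norm z0) + 0 + 1 * L2"
  have remainder: "L1-lipschitz_on ?X (remainder \<kappa> S)"
    unfolding remainder_def L1_def
    by (intro lipschitz_on_add lipschitz_on_diff lipschitz_on_constant lipschitz_on_blinfun[OF fst]
        lipschitz_on_scaleR snd bounds r_nonneg norm_ge_zero
        lipschitz_on_cmult_upper[OF second_order \<kappa>_le_1] order_refl)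
  show "(sqrt ((norm G * L1)\<^sup>2 + 0\<^sup>2)
      + norm correction * (L2 + norm first_order * (norm G * L1)))-lipschitz_on ?X
      (ansatz_map \<kappa> S)"
    unfolding ansatz_map_def
    by (intro lipschitz_on_add lipschitz_on_Pair lipschitz_on_minus lipschitz_on_constant
        lipschitz_on_blinfun lipschitz_on_diff second_order remainder order_refl)
qed

lemma norm_leading_part_le:
  assumes "norm S \<le> K"
  shows "norm (leading_part S) \<le> norm (G (first_order z0))
      + norm correction * (K * norm z0 + norm (first_order (G (first_order z0))))"
proof -
  have "norm (S z0 - first_order (G (first_order z0)))
      \<le> K * norm z0 + norm (first_order (G (first_order z0)))"
    using norm_blinfun[of S z0] mult_right_mono[OF assms norm_ge_zero[of z0]]
    by (intro order_trans[OF norm_triangle_ineq4]) linarith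
  then show ?thesis
    unfolding leading_part_def
    by (intro norm_triangle_le add_mono order_trans[OF norm_blinfun] mult_left_mono) auto
qed

lemma norm_ansatz_map_0_le:
  assumes "norm S \<le> K"
  shows "norm (ansatz_map \<kappa> S 0)
      \<le> norm G * (K * norm z0) + norm correction * (norm first_order * (norm G * (K * norm z0)))"
proof -
  have "norm (G (S z0)) \<le> norm G * (K * norm z0)"
    by (intro order_trans[OF norm_blinfun] mult_left_mono mult_right_mono assms) auto
  then show ?thesis
    unfolding ansatz_map_def remainder_def second_order_def
    by (intro norm_triangle_le add_mono order_trans[OF norm_blinfun] mult_left_mono)
      (auto simp: blinfun.bilinear_simps intro!: order_trans[OF norm_blinfun] mult_left_mono)
qed

lemma ansatz_fixed_point:
  assumes "0 \<le> K"
  obtains B where "\<forall>\<^sub>F \<kappa> in at 0. \<forall>S. norm S \<le> K \<longrightarrow>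
    (\<exists>u. norm u \<le> B \<and> leading_part S + \<kappa> *\<^sub>R ansatz_map \<kappa> S u = u)"
proof -
  define B where "B = norm (G (first_order z0))
      + norm correction * (K * norm z0 + norm (first_order (G (first_order z0))))"
  have "0 \<le> B" unfolding B_def using assms by simp
  obtain L where lip: "\<And>\<kappa> S. \<bar>\<kappa>\<bar> \<le> 1 \<Longrightarrow> norm S \<le> K \<Longrightarrow>
      L-lipschitz_on (cball 0 (B + 1)) (ansatz_map \<kappa> S)"
    by (rule lipschitz_on_ansatz_map[of "B + 1" K]) (use \<open>0 \<le> B\<close> in auto)
  define M where
    "M = norm G * (K * norm z0) + norm correction * (norm first_order * (norm G * (K * norm z0)))"
  note small = eventually_abs_mult_less[OF zero_less_one]
  have "\<forall>\<^sub>F \<kappa> in at 0. \<forall>S. norm S \<le> K \<longrightarrow>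
      (\<exists>u. norm u \<le> B + 1 \<and> leading_part S + \<kappa> *\<^sub>R ansatz_map \<kappa> S u = u)"
    using small[of 1] small[of "M + L * (B + 1)"] small[of L]
  proof eventually_elim
    case (elim \<kappa>)
    show ?case
    proof (intro allI impI)
      fix S :: "'a \<Rightarrow>\<^sub>L 'a"
      assume S_le: "norm S \<le> K"
      show "\<exists>u. norm u \<le> B + 1 \<and> leading_part S + \<kappa> *\<^sub>R ansatz_map \<kappa> S u = u"
        using small_perturbation_fixed_point[OF norm_leading_part_le[OF S_le, folded B_def]
            lip[OF _ S_le] norm_ansatz_map_0_le[OF S_le, folded M_def]] elim
        by (metis less_imp_le mult.right_neutral)
    qed
  qed
  then show ?thesis by (rule that)
qed

theorem eigenvalue_branch:
  assumes expansion: "(\<lambda>\<kappa>. norm (T \<kappa> - T0 - \<kappa> *\<^sub>R T1)) \<in> O[at 0](\<lambda>\<kappa>. \<kappa>\<^sup>2)"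
  obtains R where "\<forall>\<^sub>F \<kappa> in at 0. \<exists>\<eta> z. T \<kappa> z = (\<kappa> * \<eta>) *\<^sub>R z \<and>
    \<bar>\<eta> - \<eta>0\<bar> \<le> R * \<bar>\<kappa>\<bar> \<and> norm (z - z0) \<le> R * \<bar>\<kappa>\<bar>"
proof -
  obtain K where "0 < K" and bound: "\<forall>\<^sub>F \<kappa> in at 0. norm (T \<kappa> - T0 - \<kappa> *\<^sub>R T1) \<le> K * \<kappa>\<^sup>2"
    using landau_o.bigE[OF expansion] by auto
  obtain B where fixed_point: "\<forall>\<^sub>F \<kappa> in at 0. \<forall>S. norm S \<le> K \<longrightarrow>
      (\<exists>u. norm u \<le> B \<and> leading_part S + \<kappa> *\<^sub>R ansatz_map \<kappa> S u = u)"
    using ansatz_fixed_point \<open>0 < K\<close> less_imp_le by blast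
  have "\<forall>\<^sub>F \<kappa> in at 0. \<exists>\<eta> z. T \<kappa> z = (\<kappa> * \<eta>) *\<^sub>R z \<and>
      \<bar>\<eta> - \<eta>0\<bar> \<le> B * \<bar>\<kappa>\<bar> \<and> norm (z - z0) \<le> B * \<bar>\<kappa>\<bar>"
    using bound fixed_point eventually_neq_at_within[of "0::real" 0 UNIV]
  proof eventually_elim
    case (elim \<kappa>)
    define S where "S = (1 / \<kappa>\<^sup>2) *\<^sub>R (T \<kappa> - T0 - \<kappa> *\<^sub>R T1)"
    have T_eq: "T \<kappa> = T0 + \<kappa> *\<^sub>R T1 + \<kappa>\<^sup>2 *\<^sub>R S" using elim by (simp add: S_def)
    have "norm S \<le> K"
      unfolding S_def norm_scaleR using elim by (simp add: divide_le_eq)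
    then obtain v e where ansatz: "norm (v, e) \<le> B"
      "leading_part S + \<kappa> *\<^sub>R ansatz_map \<kappa> S (v, e) = (v, e)"
      using elim(2) by (metis surj_pair)
    have "norm v \<le> B" "\<bar>e\<bar> \<le> B" using ansatz(1) norm_fst_le[of v e] norm_snd_le[of e v] by auto
    then show ?case
      using fixed_point_eigenvector[OF ansatz(2), folded T_eq]
      by (intro exI[of _ "\<eta>0 + \<kappa> * e"] exI[of _ "z0 + \<kappa> *\<^sub>R v"])
        (auto simp: abs_mult mult.commute[of _ "\<bar>\<kappa>\<bar>"] intro!: mult_left_mono)
  qed
  then show ?thesis by (rule that)
qed

end

definition antidiagonal ::
  "('a::real_normed_vector \<Rightarrow>\<^sub>L 'b::real_normed_vector) \<Rightarrow> ('b \<Rightarrow>\<^sub>L 'a) \<Rightarrow> ('a \<times> 'b)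
      \<Rightarrow>\<^sub>L ('a \<times> 'b)" where
  "antidiagonal A B = Blinfun (\<lambda>z. (B (snd z), A (fst z)))"

lemma antidiagonal_apply [simp]: "antidiagonal A B (x, y) = (B y, A x)"
proof -
  have "bounded_linear (\<lambda>z. (B (snd z), A (fst z)))"
    by (intro bounded_linear_intros)
  then show ?thesis by (simp add: antidiagonal_def bounded_linear_Blinfun_apply)
qed

lemma antidiagonal_diff: "antidiagonal A B - antidiagonal A' B' = antidiagonal (A - A') (B - B')"
  and antidiagonal_scaleR: "r *\<^sub>R antidiagonal A B = antidiagonal (r *\<^sub>R A) (r *\<^sub>R B)"
  by (auto intro!: blinfun_eqI simp: blinfun.bilinear_simps)

lemma norm_antidiagonal_le: "norm (antidiagonal A B) \<le> norm A + norm B"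
proof (rule norm_blinfun_bound)
  fix z :: "'a \<times> 'b"
  obtain x y where z_eq: "z = (x, y)" by fastforce
  have "norm (antidiagonal A B z) \<le> norm A * norm x + norm B * norm y"
    using norm_Pair_le[of "B y" "A x"] norm_blinfun[of A x] norm_blinfun[of B y] by (simp add: z_eq)
  also have "\<dots> \<le> norm A * norm z + norm B * norm z"
    by (intro add_mono mult_left_mono) (auto simp: z_eq norm_fst_le norm_snd_le)
  finally show "norm (antidiagonal A B z) \<le> (norm A + norm B) * norm z"
    by (simp add: distrib_right)
qed simp

lemma antidiagonal_expansion:
  fixes A :: "real \<Rightarrow> 'a::real_normed_vector \<Rightarrow>\<^sub>L 'b::real_normed_vector"
  assumes expansion_A: "(\<lambda>\<kappa>. norm (A \<kappa> - A0 - \<kappa> *\<^sub>R A1)) \<in> O[at 0](\<lambda>\<kappa>. \<kappa>\<^sup>2)"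
    and expansion_B: "(\<lambda>\<kappa>. norm (B \<kappa> - B0 - \<kappa> *\<^sub>R B1)) \<in> O[at 0](\<lambda>\<kappa>. \<kappa>\<^sup>2)"
  shows "(\<lambda>\<kappa>. norm (antidiagonal (A \<kappa>) (B \<kappa>) - antidiagonal A0 B0 - \<kappa> *\<^sub>R antidiagonal A1 B1))
    \<in> O[at 0](\<lambda>\<kappa>. \<kappa>\<^sup>2)"
  unfolding antidiagonal_scaleR antidiagonal_diff
  by (rule landau_o.big_trans[OF bigoI[of _ 1] sum_in_bigo(1)[OF expansion_A expansion_B]])
    (auto intro!: always_eventually norm_antidiagonal_le)

lemma antidiagonal_pencil_eigenvalue:
  fixes a b m n :: real
  assumes "a * b > 0" "m > 0" "n > 0"
  obtains \<eta> t where "\<eta> \<noteq> 0" "t > 0" "t * b = \<eta> * n" "a = \<eta> * (t * m)"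
proof -
  define t where "t = sqrt (a / b * (n / m))"
  have "a / b > 0" using assms by (auto simp: zero_less_divide_iff zero_less_mult_iff)
  then have "a / b * (n / m) > 0" using assms by (intro mult_pos_pos[OF _ divide_pos_pos])
  then have t_square: "t > 0" "t\<^sup>2 = a / b * (n / m)" by (simp_all add: t_def)
  have "t * b / n * (t * m) = t\<^sup>2 * (b * m / n)" by (simp add: power2_eq_square)
  also have "\<dots> = a" using assms by (auto simp: t_square)
  finally have "a = t * b / n * (t * m)" by (rule sym)
  moreover have "t * b / n \<noteq> 0" "t * b = t * b / n * n" using t_square(1) assms by auto
  ultimately show ?thesis using that t_square(1) by blast
qed

theorem chiral_double_zero_splitting:
  fixes A :: "real \<Rightarrow> 'a::banach \<Rightarrow>\<^sub>L 'b::banach" and B :: "real \<Rightarrow> 'b \<Rightarrow>\<^sub>L 'a"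
    and A0 A1 GB :: "'a \<Rightarrow>\<^sub>L 'b" and B0 B1 GA :: "'b \<Rightarrow>\<^sub>L 'a"
    and \<phi> :: "'a \<Rightarrow>\<^sub>L real" and \<psi> :: "'b \<Rightarrow>\<^sub>L real"
  assumes expansion_A: "(\<lambda>\<kappa>. norm (A \<kappa> - A0 - \<kappa> *\<^sub>R A1)) \<in> O[at 0](\<lambda>\<kappa>. \<kappa>\<^sup>2)"
    and expansion_B: "(\<lambda>\<kappa>. norm (B \<kappa> - B0 - \<kappa> *\<^sub>R B1)) \<in> O[at 0](\<lambda>\<kappa>. \<kappa>\<^sup>2)"
    and kernels: "A0 x0 = 0" "B0 y0 = 0"
    and A0_GA: "\<And>h. \<psi> h = 0 \<Longrightarrow> A0 (GA h) = h" and B0_GB: "\<And>h. \<phi> h = 0 \<Longrightarrow> B0 (GB h) = h"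
    and pos: "\<phi> x0 > 0" "\<psi> y0 > 0" and coupling: "\<psi> (A1 x0) * \<phi> (B1 y0) > 0"
  obtains \<eta>0 R where "\<eta>0 \<noteq> 0"
    "\<forall>\<^sub>F \<kappa> in at 0. \<exists>\<eta> x y. A \<kappa> x = (\<kappa> * \<eta>) *\<^sub>R y \<and> B \<kappa> y = (\<kappa> * \<eta>) *\<^sub>R x \<and>
       \<bar>\<eta> - \<eta>0\<bar> \<le> R * \<bar>\<kappa>\<bar> \<and> norm (x - x0) \<le> R * \<bar>\<kappa>\<bar>"
proof -
  obtain \<eta>0 t where "\<eta>0 \<noteq> 0" "t > 0" and reduced: "t * \<phi> (B1 y0) = \<eta>0 * \<phi> x0"
    "\<psi> (A1 x0) = \<eta>0 * (t * \<psi> y0)"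
    using antidiagonal_pencil_eigenvalue[OF coupling pos(2,1)] by blast
  define functional where
    "functional s = Blinfun (\<lambda>z. \<phi> (fst z) / \<phi> x0 + s * (\<psi> (snd z) / (t * \<psi> y0)))" for s
  have functional: "functional s (x, y) = \<phi> x / \<phi> x0 + s * (\<psi> y / (t * \<psi> y0))" for s x y
  proof -
    have "bounded_linear (\<lambda>z. \<phi> (fst z) / \<phi> x0 + s * (\<psi> (snd z) / (t * \<psi> y0)))"
      unfolding divide_inverse by (intro bounded_linear_intros)
    then show ?thesis by (simp add: functional_def bounded_linear_Blinfun_apply)
  qed
  interpret double_eigenvalue "antidiagonal A0 B0" "antidiagonal A1 B1" "antidiagonal GB GA"
    "functional 1" "functional (- 1)" "(x0, t *\<^sub>R y0)" "(x0, - t *\<^sub>R y0)" \<eta>0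
  proof
    fix h assume annihilated: "functional 1 h = 0" "functional (- 1) h = 0"
    have "\<phi> (fst h) / \<phi> x0 = 0" "\<psi> (snd h) / (t * \<psi> y0) = 0"
      using annihilated functional[of 1 "fst h" "snd h"] functional[of "- 1" "fst h" "snd h"]
      by auto
    then have "\<phi> (fst h) = 0" "\<psi> (snd h) = 0" using pos \<open>t > 0\<close> by simp_all
    then show "antidiagonal A0 B0 (antidiagonal GB GA h) = h"
      using A0_GA B0_GB by (cases h) simp
  qed (use pos \<open>t > 0\<close> \<open>\<eta>0 \<noteq> 0\<close> in
      \<open>auto simp: functional kernels reduced zero_prod_def blinfun.bilinear_simps\<close>)
  obtain R where "\<forall>\<^sub>F \<kappa> in at 0. \<exists>\<eta> z. antidiagonal (A \<kappa>) (B \<kappa>) z = (\<kappa> * \<eta>) *\<^sub>R z \<and>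
      \<bar>\<eta> - \<eta>0\<bar> \<le> R * \<bar>\<kappa>\<bar> \<and> norm (z - (x0, t *\<^sub>R y0)) \<le> R * \<bar>\<kappa>\<bar>"
    using eigenvalue_branch[OF antidiagonal_expansion[OF expansion_A expansion_B]] by blast
  then have "\<forall>\<^sub>F \<kappa> in at 0. \<exists>\<eta> x y. A \<kappa> x = (\<kappa> * \<eta>) *\<^sub>R y \<and> B \<kappa> y = (\<kappa> * \<eta>) *\<^sub>R x \<and>
       \<bar>\<eta> - \<eta>0\<bar> \<le> R * \<bar>\<kappa>\<bar> \<and> norm (x - x0) \<le> R * \<bar>\<kappa>\<bar>"
  proof eventually_elim
    case (elim \<kappa>)
    then obtain \<eta> x y where "antidiagonal (A \<kappa>) (B \<kappa>) (x, y) = (\<kappa> * \<eta>) *\<^sub>R (x, y)"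
      "\<bar>\<eta> - \<eta>0\<bar> \<le> R * \<bar>\<kappa>\<bar>" "norm ((x, y) - (x0, t *\<^sub>R y0)) \<le> R * \<bar>\<kappa>\<bar>" by force
    moreover have "norm (x - x0) \<le> norm ((x, y) - (x0, t *\<^sub>R y0))" by (simp add: norm_fst_le)
    ultimately show ?case by (intro exI[of _ \<eta>] exI[of _ x] exI[of _ y]) auto
  qed
  then show ?thesis using that \<open>\<eta>0 \<noteq> 0\<close> by blast
qed

lemma trigonometric_expansion:
  fixes S C D :: "'a::real_normed_vector \<Rightarrow>\<^sub>L 'b::real_normed_vector"
  shows "(\<lambda>\<kappa>. norm ((S + cos \<kappa> *\<^sub>R C + sin \<kappa> *\<^sub>R D) - (S + C) - \<kappa> *\<^sub>R D)) \<in> O[at 0](\<lambda>\<kappa>. \<kappa>\<^sup>2)"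
proof -
  have "norm ((S + cos \<kappa> *\<^sub>R C + sin \<kappa> *\<^sub>R D) - (S + C) - \<kappa> *\<^sub>R D)
      \<le> norm C * \<bar>1 - cos \<kappa>\<bar> + norm D * \<bar>sin \<kappa> - \<kappa>\<bar>" for \<kappa>
  proof -
    have "(S + cos \<kappa> *\<^sub>R C + sin \<kappa> *\<^sub>R D) - (S + C) - \<kappa> *\<^sub>R D
        = (cos \<kappa> - 1) *\<^sub>R C + (sin \<kappa> - \<kappa>) *\<^sub>R D"
      by (simp add: algebra_simps)
    then show ?thesis
      using norm_triangle_ineq[of "(cos \<kappa> - 1) *\<^sub>R C" "(sin \<kappa> - \<kappa>) *\<^sub>R D"]
      by (simp add: mult.commute abs_minus_commute)
  qed
  then have bound: "\<forall>\<^sub>F \<kappa> in at 0. norm (norm ((S + cos \<kappa> *\<^sub>R C + sin \<kappa> *\<^sub>R D) - (S + C) - \<kappa> *\<^sub>R D))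
      \<le> 1 * norm (norm C * \<bar>1 - cos \<kappa>\<bar> + norm D * \<bar>sin \<kappa> - \<kappa>\<bar>)"
    by (simp add: always_eventually)
  have "(\<lambda>\<kappa>::real. norm C * \<bar>1 - cos \<kappa>\<bar> + norm D * \<bar>sin \<kappa> - \<kappa>\<bar>) \<in> O[at 0](\<lambda>\<kappa>. \<kappa>\<^sup>2)"
  proof (rule sum_in_bigo)
    have "(\<lambda>\<kappa>::real. 1 - cos \<kappa>) \<in> O[at 0](\<lambda>\<kappa>. \<kappa>\<^sup>2)" by real_asymp
    then show "(\<lambda>\<kappa>::real. norm C * \<bar>1 - cos \<kappa>\<bar>) \<in> O[at 0](\<lambda>\<kappa>. \<kappa>\<^sup>2)" by (cases "norm C = 0") auto
    have "(\<lambda>\<kappa>::real. sin \<kappa> - \<kappa>) \<in> O[at 0](\<lambda>\<kappa>. \<kappa>\<^sup>2)" by real_asymp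
    then show "(\<lambda>\<kappa>::real. norm D * \<bar>sin \<kappa> - \<kappa>\<bar>) \<in> O[at 0](\<lambda>\<kappa>. \<kappa>\<^sup>2)" by (cases "norm D = 0") auto
  qed
  then show ?thesis by (rule landau_o.big_trans[OF bigoI[OF bound]])
qed

section \<open>Two-sided geometric sequences\<close>

lemma bigtheta_at_top_if_ratio:
  fixes \<omega> :: "int \<Rightarrow> real"
  assumes "0 < x" "\<omega> N \<noteq> 0" and ratio: "\<And>n. N \<le> n \<Longrightarrow> \<omega> (n + 1) = x * \<omega> n"
  shows "\<omega> \<in> \<Theta>[at_top](\<lambda>n. x powi n)"
proof -
  have explicit: "\<omega> n = \<omega> N / x powi N * x powi n" if "N \<le> n" for n
    using that
  proof (induction n rule: int_ge_induct)
    case base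
    then show ?case using \<open>0 < x\<close> by simp
  next
    case (step n)
    then show ?case using ratio[of n] \<open>0 < x\<close> by (simp add: power_int_add)
  qed
  have "\<forall>\<^sub>F n in at_top. \<omega> N / x powi N * x powi n = \<omega> n"
    using eventually_ge_at_top[of N] by eventually_elim (rule explicit[symmetric])
  then show ?thesis by (rule landau_theta.in_cong[THEN iffD1]) (use assms in simp)
qed

lemma bigtheta_at_bot_if_ratio:
  fixes \<omega> :: "int \<Rightarrow> real"
  assumes "0 < y" "\<omega> N \<noteq> 0" and ratio: "\<And>n. n < N \<Longrightarrow> \<omega> (n + 1) = y * \<omega> n"
  shows "\<omega> \<in> \<Theta>[at_bot](\<lambda>n. y powi n)"
proof -
  have explicit: "\<omega> n = \<omega> N / y powi N * y powi n" if "n \<le> N" for n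
    using that
  proof (induction n rule: int_le_induct)
    case base
    then show ?case using \<open>0 < y\<close> by simp
  next
    case (step n)
    then show ?case using ratio[of "n - 1"] \<open>0 < y\<close> by (simp add: power_int_diff field_simps)
  qed
  have "\<forall>\<^sub>F n in at_bot. \<omega> N / y powi N * y powi n = \<omega> n"
    using eventually_le_at_bot[of N] by eventually_elim (rule explicit[symmetric])
  then show ?thesis by (rule landau_theta.in_cong[THEN iffD1]) (use assms in simp)
qed

text \<open>Since \<open>\<alpha> y\<^sup>2 + \<beta> y = 1\<close>, the recurrence expresses \<open>\<omega>\<^sub>n\<^sub>-\<^sub>2 / y\<^bsup>n-2\<^esup>\<close> as a convex
  combination of the two preceding quotients, which hence stay between their initial values.\<close>

lemma bigtheta_at_bot_if_two_term_recurrence: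
  fixes \<omega> :: "int \<Rightarrow> real"
  assumes pos: "\<And>n. 0 < \<omega> n" and y_pos: "0 < y" and coeffs: "0 \<le> \<alpha>" "0 \<le> \<beta>" "\<alpha> * y\<^sup>2 + \<beta> * y = 1"
    and rec: "\<And>n. n \<le> N \<Longrightarrow> \<omega> (n - 2) = \<alpha> * \<omega> n + \<beta> * \<omega> (n - 1)"
  shows "\<omega> \<in> \<Theta>[at_bot](\<lambda>n. y powi n)"
proof -
  define q where "q n = \<omega> n / y powi n" for n
  define A where "A = min (q N) (q (N - 1))"
  define B where "B = max (q N) (q (N - 1))"
  have q_pos: "0 < q n" for n using pos y_pos by (simp add: q_def)
  have q_rec: "q (n - 2) = \<alpha> * y\<^sup>2 * q n + \<beta> * y * q (n - 1)" if "n \<le> N" for n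
    unfolding q_def using rec[OF that] y_pos
    by (simp add: power_int_diff field_simps power2_eq_square)
  have between: "A \<le> q n \<and> q n \<le> B \<and> A \<le> q (n - 1) \<and> q (n - 1) \<le> B" if "n \<le> N" for n
    using that
  proof (induction n rule: int_le_induct)
    case base
    then show ?case by (simp add: A_def B_def)
  next
    case (step n)
    have nonneg: "0 \<le> \<alpha> * y\<^sup>2" "0 \<le> \<beta> * y" using coeffs y_pos by simp_all
    have "\<alpha> * y\<^sup>2 * A + \<beta> * y * A \<le> q (n - 2)" "q (n - 2) \<le> \<alpha> * y\<^sup>2 * B + \<beta> * y * B"
      unfolding q_rec[OF step(1)] using step.IH nonneg by (auto intro!: add_mono mult_left_mono)
    then show ?case using step.IH coeffs(3) by (simp flip: distrib_right)
  qed
  have "\<forall>\<^sub>F n in at_bot. norm (\<omega> n) \<ge> A * norm (y powi n) \<and> norm (\<omega> n) \<le> B * norm (y powi n)"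
    using eventually_le_at_bot[of N]
  proof eventually_elim
    case (elim n)
    then show ?case using between[of n] pos[of n] y_pos by (simp add: q_def field_simps)
  qed
  moreover have "0 < A" "0 < B" using q_pos by (simp_all add: A_def B_def less_max_iff_disj)
  ultimately show ?thesis by (intro bigthetaI') auto
qed

definition two_sided_power :: "real \<Rightarrow> real \<Rightarrow> int \<Rightarrow> real" where
  "two_sided_power x y n = (if 0 \<le> n then x powi n else y powi n)"

definition two_sided_geometric :: "real \<Rightarrow> real \<Rightarrow> (int \<Rightarrow> real) \<Rightarrow> bool" where
  "two_sided_geometric x y \<omega> \<longleftrightarrow> 0 < x \<and> 0 < y \<and> (\<forall>n. 0 < \<omega> n) \<and>
     \<omega> \<in> \<Theta>[at_top](\<lambda>n. x powi n) \<and> \<omega> \<in> \<Theta>[at_bot](\<lambda>n. y powi n)"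

lemma two_sided_geometric_divide:
  assumes "two_sided_geometric x y \<omega>" "two_sided_geometric x' y' \<omega>'"
  shows "two_sided_geometric (x / x') (y / y') (\<lambda>n. \<omega> n / \<omega>' n)"
proof -
  have nonzero: "\<omega>' n \<noteq> 0" for n
    using assms(2) unfolding two_sided_geometric_def by (metis less_irrefl)
  have "(\<lambda>n. \<omega> n / \<omega>' n) \<in> \<Theta>[F](\<lambda>n. (z / z') powi n)"
    if "\<omega> \<in> \<Theta>[F](\<lambda>n. z powi n)" "\<omega>' \<in> \<Theta>[F](\<lambda>n. z' powi n)" "0 < z'" for F z z'
    unfolding power_int_divide_distrib
    using that nonzero by (intro landau_theta.divide always_eventually) (auto simp: bigtheta_sym)
  then show ?thesis using assms unfolding two_sided_geometric_def by simp
qed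

lemma two_sided_geometric_shift:
  assumes "two_sided_geometric x y \<omega>"
  shows "two_sided_geometric x y (\<lambda>n. \<omega> (n + j))"
proof -
  have "(\<lambda>n. \<omega> (n + j)) \<in> \<Theta>[F](\<lambda>n. z powi n)"
    if "\<omega> \<in> \<Theta>[F](\<lambda>n. z powi n)" "filterlim (\<lambda>n. n + j) F F" "0 < z" for F z
  proof -
    have "(\<lambda>n. \<omega> (n + j)) \<in> \<Theta>[F](\<lambda>n. z powi (n + j))"
      using landau_theta.compose[OF that(1,2)] .
    also have "(\<lambda>n. z powi (n + j)) = (\<lambda>n. z powi j * z powi n)"
      using that(3) by (simp add: power_int_add mult.commute)
    finally show ?thesis using that(3) by simp
  qed
  moreover have "filterlim (\<lambda>n. n + j) at_top at_top"
    unfolding filterlim_at_top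
  proof
    show "\<forall>\<^sub>F n in at_top. Z \<le> n + j" for Z
      using eventually_ge_at_top[of "Z - j"] by eventually_elim simp
  qed
  moreover have "filterlim (\<lambda>n. n + j) at_bot at_bot"
    unfolding filterlim_at_bot
  proof
    show "\<forall>\<^sub>F n in at_bot. n + j \<le> Z" for Z
      using eventually_le_at_bot[of "Z - j"] by eventually_elim simp
  qed
  ultimately show ?thesis using assms unfolding two_sided_geometric_def by simp
qed

lemma bounded_if_bigo_at_both_ends:
  fixes q :: "int \<Rightarrow> real"
  assumes "q \<in> O[at_top](\<lambda>_. 1)" "q \<in> O[at_bot](\<lambda>_. 1)"
  obtains B where "\<And>n. \<bar>q n\<bar> \<le> B"
proof -
  obtain b where "\<forall>\<^sub>F n in at_top. \<bar>q n\<bar> \<le> b" using landau_o.bigE[OF assms(1)] by auto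
  then obtain M where top: "\<And>n. M \<le> n \<Longrightarrow> \<bar>q n\<bar> \<le> b" unfolding eventually_at_top_linorder by blast
  obtain b' where "\<forall>\<^sub>F n in at_bot. \<bar>q n\<bar> \<le> b'" using landau_o.bigE[OF assms(2)] by auto
  then obtain N where bot: "\<And>n. n \<le> N \<Longrightarrow> \<bar>q n\<bar> \<le> b'" unfolding eventually_at_bot_linorder by blast
  define m where "m = Max ((\<lambda>n. \<bar>q n\<bar>) ` {N..M})"
  have middle: "\<bar>q n\<bar> \<le> m" if "N \<le> n" "n \<le> M" for n
    unfolding m_def using that by (intro Max_ge) auto
  have "\<bar>q n\<bar> \<le> max (max b b') m" for n
    using top[of n] bot[of n] middle[of n] by linarith
  then show ?thesis using that by blast
qed

lemma two_sided_geometric_ratio_le: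
  assumes "two_sided_geometric x y \<omega>"
  obtains C where "0 \<le> C" "\<And>m n. \<omega> n / \<omega> m \<le> C * (two_sided_power x y n / two_sided_power x y m)"
proof -
  note geom = assms[unfolded two_sided_geometric_def]
  define E where "E = two_sided_power x y"
  have E_pos: "0 < E n" for n using geom by (simp add: E_def two_sided_power_def)
  have "\<forall>\<^sub>F n in at_top. x powi n = E n"
    using eventually_ge_at_top[of 0] by eventually_elim (simp add: E_def two_sided_power_def)
  from landau_theta.cong[OF this] have top: "\<omega> \<in> \<Theta>[at_top](E)" using geom by blast
  have "\<forall>\<^sub>F n in at_bot. y powi n = E n"
    using eventually_le_at_bot[of "- 1"] by eventually_elim (simp add: E_def two_sided_power_def)
  from landau_theta.cong[OF this] have bot: "\<omega> \<in> \<Theta>[at_bot](E)" using geom by blast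
  have nonzero: "\<omega> n \<noteq> 0" "E n \<noteq> 0" for n using geom E_pos by (metis less_irrefl)+
  have ratio: "(\<lambda>n. \<omega> n / E n) \<in> O[F](\<lambda>_. 1)" "(\<lambda>n. E n / \<omega> n) \<in> O[F](\<lambda>_. 1)"
    if "\<omega> \<in> \<Theta>[F](E)" for F
    using that nonzero by (simp_all add: landau_o.big.divide_eq2 bigthetaD1 bigtheta_sym)
  obtain A where upper: "\<And>n. \<bar>\<omega> n / E n\<bar> \<le> A"
    using bounded_if_bigo_at_both_ends[OF ratio(1)[OF top] ratio(1)[OF bot]] by blast
  obtain B where lower: "\<And>n. \<bar>E n / \<omega> n\<bar> \<le> B"
    using bounded_if_bigo_at_both_ends[OF ratio(2)[OF top] ratio(2)[OF bot]] by blast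
  have nonneg: "0 \<le> A" "0 \<le> B" using upper[of 0] lower[of 0] by linarith+
  have "\<omega> n / \<omega> m \<le> A * B * (E n / E m)" for m n
  proof -
    have "\<omega> n / \<omega> m = (\<omega> n / E n) * (E m / \<omega> m) * (E n / E m)" using nonzero by simp
    also have "\<dots> \<le> A * B * (E n / E m)"
      using upper[of n] lower[of m] nonneg E_pos geom
      by (intro mult_right_mono mult_mono) (auto simp: less_imp_le)
    finally show ?thesis .
  qed
  then show ?thesis using that[of "A * B"] nonneg by (simp add: E_def)
qed

lemma power_int_nonpos_exp: "n \<le> 0 \<Longrightarrow> y powi n = (1 / y) ^ nat (- n)" for y :: real
  by (simp add: power_int_def power_inverse divide_inverse)

lemma two_sided_power_nonpos: "n \<le> 0 \<Longrightarrow> two_sided_power x y n = y powi n"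
  by (cases "n = 0") (auto simp: two_sided_power_def)

lemma two_sided_power_divide_le:
  assumes x_bounds: "0 < x" "x \<le> \<rho>" and y_bounds: "0 < y" "1 / y \<le> \<rho>"
    and same_side: "0 \<le> m \<and> m \<le> n \<or> n \<le> m \<and> m \<le> 0"
  shows "two_sided_power x y n / two_sided_power x y m \<le> \<rho> ^ nat \<bar>n - m\<bar>"
proof (cases "0 \<le> m \<and> m \<le> n")
  case True
  then have "two_sided_power x y n / two_sided_power x y m = x powi (n - m)"
    using x_bounds by (simp add: two_sided_power_def power_int_diff)
  also have "\<dots> = x ^ nat \<bar>n - m\<bar>" using True by (simp add: power_int_nonneg_exp)
  finally show ?thesis using x_bounds by (simp add: power_mono)
next
  case False
  then have "n \<le> m" "m \<le> 0" using same_side by auto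
  then have "two_sided_power x y n / two_sided_power x y m = y powi (n - m)"
    using y_bounds by (simp add: two_sided_power_nonpos power_int_diff)
  also have "\<dots> = (1 / y) ^ nat \<bar>n - m\<bar>"
    using \<open>n \<le> m\<close> by (simp add: power_int_nonpos_exp del: power_one_over)
  finally show ?thesis using y_bounds by (simp add: power_mono del: power_one_over)
qed

lemma two_sided_power_le_growth:
  assumes pos: "0 < x" "0 < y" "0 < \<rho>" and growth: "1 \<le> \<rho> * x" "1 \<le> \<rho> * y" and "n \<le> m"
  shows "two_sided_power x y n \<le> \<rho> ^ nat (m - n) * two_sided_power x y m"
proof -
  have step: "two_sided_power x y k \<le> \<rho> * two_sided_power x y (k + 1)" for k
  proof (cases "0 \<le> k")
    case True
    then have "x powi k * 1 \<le> x powi k * (\<rho> * x)" using growth pos by (intro mult_left_mono) auto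
    then show ?thesis using True pos by (simp add: two_sided_power_def power_int_add mult_ac)
  next
    case False
    then have "y powi k * 1 \<le> y powi k * (\<rho> * y)" using growth pos by (intro mult_left_mono) auto
    then show ?thesis using False pos by (simp add: two_sided_power_nonpos power_int_add mult_ac)
  qed
  show ?thesis
    using \<open>n \<le> m\<close>
  proof (induction m rule: int_ge_induct)
    case (step m)
    have "\<rho> ^ nat (m - n) * two_sided_power x y m
        \<le> \<rho> ^ nat (m - n) * (\<rho> * two_sided_power x y (m + 1))"
      using pos \<open>\<And>k. two_sided_power x y k \<le> _\<close> by (intro mult_left_mono) auto
    moreover have "nat (m + 1 - n) = Suc (nat (m - n))" using step.hyps by simp
    ultimately show ?case using step.IH by (simp add: mult_ac)
  qed simp
qed

section \<open>Operators on exponentially decaying sequences\<close>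

lemma summable_on_geometric_int:
  fixes r :: real
  assumes "0 \<le> r" "r < 1"
  shows "(\<lambda>n::int. r ^ nat \<bar>n\<bar>) summable_on UNIV"
proof -
  have nat: "(\<lambda>k. r ^ k) summable_on (UNIV :: nat set)"
    using assms by (intro summable_nonneg_imp_summable_on summable_geometric) auto
  have right: "(\<lambda>n::int. r ^ nat \<bar>n\<bar>) summable_on range int"
    using nat by (subst summable_on_reindex) (auto simp: o_def)
  have "(\<lambda>n::int. r ^ nat \<bar>n\<bar>) \<circ> (\<lambda>k. - int (Suc k)) = (\<lambda>k. r * r ^ k)"
    by (auto simp: nat_add_distrib)
  then have left: "(\<lambda>n::int. r ^ nat \<bar>n\<bar>) summable_on range (\<lambda>k. - int (Suc k))"
    using summable_on_cmult_right[OF nat, of r] by (subst summable_on_reindex) (auto simp: inj_def)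
  have "n \<in> range int \<union> range (\<lambda>k. - int (Suc k))" for n
    by (cases n rule: int_cases) blast+
  then have "range int \<union> range (\<lambda>k. - int (Suc k)) = UNIV" by blast
  moreover have "range int \<inter> range (\<lambda>k. - int (Suc k)) = {}" by auto
  ultimately show ?thesis using summable_on_Un_disjoint[OF right left] by simp
qed

lemma summable_on_if_geometric_bound:
  fixes x :: "int \<Rightarrow> real"
  assumes "0 \<le> r" "r < 1" "\<And>n. \<bar>x n\<bar> \<le> C * r ^ nat \<bar>n\<bar>"
  shows "x summable_on UNIV"
proof (rule abs_summable_summable[OF Infinite_Sum.abs_summable_on_comparison_test'])
  show "(\<lambda>n. C * r ^ nat \<bar>n\<bar>) summable_on UNIV"
    by (intro summable_on_cmult_right summable_on_geometric_int assms)
qed (use assms in auto)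

lemma infsum_delta_mult: "(\<Sum>\<^sub>\<infinity>m. (if m = n then 1 else 0) * x m) = (x n :: real)"
proof -
  have "(\<Sum>\<^sub>\<infinity>m. (if m = n then 1 else 0) * x m) = (\<Sum>\<^sub>\<infinity>m\<in>{n}. x m)"
    by (rule infsum_cong_neutral) auto
  then show ?thesis by simp
qed

instance bcontfun :: (metric_space, banach) banach ..

type_synonym sequence = "int discrete \<Rightarrow>\<^sub>C real"

locale exponential_weight =
  fixes \<sigma> :: real
  assumes \<sigma>_pos: "0 < \<sigma>" and \<sigma>_less_1: "\<sigma> < 1"
begin

text \<open>The weight \<open>\<sigma>\<^bsup>|n|\<^esup>\<close> identifies the Banach space of bounded sequences with the space of
  sequences that are \<open>O(\<sigma>\<^bsup>|n|\<^esup>)\<close>.\<close>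

definition seq :: "sequence \<Rightarrow> int \<Rightarrow> real" where
  "seq x n = \<sigma> ^ nat \<bar>n\<bar> * apply_bcontfun x (discrete n)"

definition of_seq :: "(int \<Rightarrow> real) \<Rightarrow> sequence" where
  "of_seq h = Bcontfun (\<lambda>m. h (of_discrete m) / \<sigma> ^ nat \<bar>of_discrete m\<bar>)"

definition exp_bounded :: "(int \<Rightarrow> real) \<Rightarrow> bool" where
  "exp_bounded h \<longleftrightarrow> (\<exists>C. \<forall>n. \<bar>h n\<bar> \<le> C * \<sigma> ^ nat \<bar>n\<bar>)"

lemma seq_simps [simp]:
  "seq (x + y) n = seq x n + seq y n" "seq (x - y) n = seq x n - seq y n" "seq (- x) n = - seq x n"
  "seq (a *\<^sub>R x) n = a * seq x n" "seq 0 n = 0"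
  by (simp_all add: seq_def algebra_simps)

lemma abs_seq_le: "\<bar>seq x n\<bar> \<le> norm x * \<sigma> ^ nat \<bar>n\<bar>"
  using norm_bounded[of x "discrete n"] \<sigma>_pos by (simp add: seq_def abs_mult mult.commute)

lemma seq_eqI:
  assumes "\<And>n. seq x n = seq y n"
  shows "x = y"
proof (rule bcontfun_eqI)
  show "apply_bcontfun x m = apply_bcontfun y m" for m
    using assms[of "of_discrete m"] \<sigma>_pos by (simp add: seq_def of_discrete_inverse)
qed

lemma seq_nonzeroE:
  assumes "x \<noteq> 0"
  obtains n where "seq x n \<noteq> 0"
  using assms seq_eqI[of x 0] by (metis seq_simps(5))

lemma of_seq_bound:
  assumes h_bound: "\<And>n. \<bar>h n\<bar> \<le> C * \<sigma> ^ nat \<bar>n\<bar>"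
  shows "seq (of_seq h) = h" "norm (of_seq h) \<le> C"
proof -
  let ?g = "\<lambda>m. h (of_discrete m) / \<sigma> ^ nat \<bar>of_discrete m\<bar>"
  have bound: "norm (?g m) \<le> C" for m
    using h_bound[of "of_discrete m"] \<sigma>_pos by (simp add: field_simps)
  have "continuous_on UNIV ?g" by (auto simp: continuous_on_open_vimage open_discrete)
  then have apply_of_seq: "apply_bcontfun (of_seq h) = ?g"
    unfolding of_seq_def using bound by (intro Bcontfun_inverse bcontfun_normI)
  show "seq (of_seq h) = h" using \<sigma>_pos by (auto simp: seq_def apply_of_seq discrete_inverse)
  show "norm (of_seq h) \<le> C" using bound by (intro norm_bound) (simp add: apply_of_seq)
qed

lemma seq_of_seq: "exp_bounded h \<Longrightarrow> seq (of_seq h) = h"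
  unfolding exp_bounded_def using of_seq_bound(1) by blast

definition operator :: "(sequence \<Rightarrow> int \<Rightarrow> real) \<Rightarrow> sequence \<Rightarrow>\<^sub>L sequence" where
  "operator \<Phi> = Blinfun (\<lambda>x. of_seq (\<Phi> x))"

lemma seq_operator:
  assumes "\<And>x y n. \<Phi> (x + y) n = \<Phi> x n + \<Phi> y n" "\<And>a x n. \<Phi> (a *\<^sub>R x) n = a * \<Phi> x n"
    and bound: "\<And>x n. \<bar>\<Phi> x n\<bar> \<le> norm x * C * \<sigma> ^ nat \<bar>n\<bar>"
  shows "seq (operator \<Phi> x) = \<Phi> x"
proof -
  note of_seq = of_seq_bound[OF bound]
  have "bounded_linear (\<lambda>x. of_seq (\<Phi> x))"
    by (rule bounded_linear_intro[of _ C])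
      (auto intro!: seq_eqI of_seq(2) simp: of_seq(1) assms(1,2))
  then show ?thesis by (simp add: operator_def bounded_linear_Blinfun_apply of_seq(1))
qed

definition shift_op :: "(int \<Rightarrow> real) \<Rightarrow> int \<Rightarrow> sequence \<Rightarrow>\<^sub>L sequence" where
  "shift_op a j = operator (\<lambda>x n. a n * seq x (n + j))"

lemma seq_shift_op:
  assumes "bounded (range a)"
  shows "seq (shift_op a j x) n = a n * seq x (n + j)"
proof -
  obtain A where a_bound: "\<And>n. \<bar>a n\<bar> \<le> A" using assms by (auto simp: bounded_iff)
  have "\<bar>a n * seq x (n + j)\<bar> \<le> norm x * (A / \<sigma> ^ nat \<bar>j\<bar>) * \<sigma> ^ nat \<bar>n\<bar>" for x n
  proof -
    have "\<sigma> ^ nat \<bar>n + j\<bar> * \<sigma> ^ nat \<bar>j\<bar> \<le> \<sigma> ^ nat \<bar>n\<bar>"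
      using \<sigma>_pos \<sigma>_less_1 by (auto simp flip: power_add intro!: power_decreasing)
    then have "norm x * \<sigma> ^ nat \<bar>n + j\<bar> \<le> norm x * (\<sigma> ^ nat \<bar>n\<bar> / \<sigma> ^ nat \<bar>j\<bar>)"
      using \<sigma>_pos by (intro mult_left_mono) (auto simp: field_simps)
    then have "\<bar>seq x (n + j)\<bar> \<le> norm x * (\<sigma> ^ nat \<bar>n\<bar> / \<sigma> ^ nat \<bar>j\<bar>)"
      using abs_seq_le order_trans by blast
    then have "\<bar>a n\<bar> * \<bar>seq x (n + j)\<bar> \<le> A * (norm x * (\<sigma> ^ nat \<bar>n\<bar> / \<sigma> ^ nat \<bar>j\<bar>))"
      using a_bound[of n] by (intro mult_mono) auto
    then show ?thesis by (simp add: abs_mult mult_ac)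
  qed
  then have "seq (shift_op a j x) = (\<lambda>n. a n * seq x (n + j))" for x
    unfolding shift_op_def
    by (intro seq_operator[of _ "A / \<sigma> ^ nat \<bar>j\<bar>"])
      (simp_all add: distrib_left mult.left_commute)
  then show ?thesis by simp
qed

definition pairing :: "(int \<Rightarrow> real) \<Rightarrow> sequence \<Rightarrow>\<^sub>L real" where
  "pairing \<omega> = Blinfun (\<lambda>x. \<Sum>\<^sub>\<infinity>m. \<omega> m * seq x m)"

lemma pairing:
  assumes "exp_bounded \<omega>"
  shows summable_on_pairing: "(\<lambda>m. \<omega> m * seq x m) summable_on UNIV"
    and pairing_apply: "pairing \<omega> x = (\<Sum>\<^sub>\<infinity>m. \<omega> m * seq x m)"
proof -
  obtain C where \<omega>_bound: "\<And>n. \<bar>\<omega> n\<bar> \<le> C * \<sigma> ^ nat \<bar>n\<bar>" using assms by (auto simp: exp_bounded_def)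
  have bound: "\<bar>\<omega> m * seq x m\<bar> \<le> (norm x * C) * \<sigma> ^ nat \<bar>m\<bar>" for x m
  proof -
    have "\<sigma> ^ nat \<bar>m\<bar> \<le> 1" using \<sigma>_pos \<sigma>_less_1 by (simp add: power_le_one)
    then have "\<bar>seq x m\<bar> \<le> norm x"
      using mult_left_mono[of "\<sigma> ^ nat \<bar>m\<bar>" 1 "norm x"] abs_seq_le[of x m] by simp
    then have "\<bar>\<omega> m\<bar> * \<bar>seq x m\<bar> \<le> (C * \<sigma> ^ nat \<bar>m\<bar>) * norm x"
      using \<omega>_bound[of m] by (intro mult_mono) auto
    then show ?thesis by (simp add: abs_mult mult_ac)
  qed
  show summable: "(\<lambda>m. \<omega> m * seq x m) summable_on UNIV" for x
    by (rule summable_on_if_geometric_bound[OF _ \<sigma>_less_1 bound]) (use \<sigma>_pos in simp)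
  have "bounded_linear (\<lambda>x. \<Sum>\<^sub>\<infinity>m. \<omega> m * seq x m)"
  proof (rule bounded_linear_intro)
    show "(\<Sum>\<^sub>\<infinity>m. \<omega> m * seq (x + y) m) = (\<Sum>\<^sub>\<infinity>m. \<omega> m * seq x m) + (\<Sum>\<^sub>\<infinity>m. \<omega> m * seq y m)" for x y
      by (simp add: distrib_left infsum_add summable)
    show "(\<Sum>\<^sub>\<infinity>m. \<omega> m * seq (a *\<^sub>R x) m) = a *\<^sub>R (\<Sum>\<^sub>\<infinity>m. \<omega> m * seq x m)" for a x
      by (simp add: mult.left_commute infsum_cmult_right')
    have geometric: "(\<lambda>m::int. \<sigma> ^ nat \<bar>m\<bar>) summable_on UNIV"
      using \<sigma>_pos \<sigma>_less_1 by (intro summable_on_geometric_int) auto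
    show "norm (\<Sum>\<^sub>\<infinity>m. \<omega> m * seq x m) \<le> norm x * (C * (\<Sum>\<^sub>\<infinity>m::int. \<sigma> ^ nat \<bar>m\<bar>))" for x
    proof -
      have "norm (\<Sum>\<^sub>\<infinity>m. \<omega> m * seq x m) \<le> (\<Sum>\<^sub>\<infinity>m. (norm x * C) * \<sigma> ^ nat \<bar>m\<bar>)"
        by (rule norm_infsum_le[OF has_sum_infsum[OF summable]
              has_sum_infsum[OF summable_on_cmult_right[OF geometric]]])
          (use bound in auto)
      then show ?thesis by (simp add: infsum_cmult_right' mult.assoc)
    qed
  qed
  then show "pairing \<omega> x = (\<Sum>\<^sub>\<infinity>m. \<omega> m * seq x m)"
    by (simp add: pairing_def bounded_linear_Blinfun_apply)
qed

lemma pairing_pos: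
  assumes "exp_bounded \<omega>" "\<And>n. 0 < \<omega> n" "\<And>n. 0 < seq x n"
  shows "0 < pairing \<omega> x"
proof -
  have "infsum (\<lambda>m. \<omega> m * seq x m) {0} \<le> infsum (\<lambda>m. \<omega> m * seq x m) UNIV"
    using assms by (intro infsum_mono2 summable_on_pairing) (auto intro: less_imp_le)
  moreover have "0 < \<omega> 0 * seq x 0" using assms by simp
  ultimately show ?thesis unfolding pairing_apply[OF assms(1)] by simp
qed

definition exp_kernel :: "(int \<Rightarrow> int \<Rightarrow> real) \<Rightarrow> bool" where
  "exp_kernel K \<longleftrightarrow> (\<exists>\<rho> C. 0 < \<rho> \<and> \<rho> < \<sigma> \<and> (\<forall>n m. \<bar>K n m\<bar> \<le> C * \<rho> ^ nat \<bar>n - m\<bar>))"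

lemma exp_kernel_transpose: "exp_kernel K \<Longrightarrow> exp_kernel (\<lambda>n m. K m n)"
  unfolding exp_kernel_def by (metis abs_minus_commute)

definition kernel_op :: "(int \<Rightarrow> int \<Rightarrow> real) \<Rightarrow> sequence \<Rightarrow>\<^sub>L sequence" where
  "kernel_op K = operator (\<lambda>x n. \<Sum>\<^sub>\<infinity>m. K n m * seq x m)"

lemma kernel_term_bound:
  assumes "\<bar>k\<bar> \<le> C * \<rho> ^ nat \<bar>n - m\<bar>"
  shows "\<bar>k * seq x m\<bar> \<le> (norm x * C * \<sigma> ^ nat \<bar>n\<bar>) * (\<rho> / \<sigma>) ^ nat \<bar>m - n\<bar>"
proof -
  have nonneg: "0 \<le> C * \<rho> ^ nat \<bar>n - m\<bar>" using assms by linarith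
  have "nat \<bar>n\<bar> \<le> nat \<bar>m\<bar> + nat \<bar>n - m\<bar>" by linarith
  then have "\<sigma> ^ nat \<bar>m\<bar> * \<sigma> ^ nat \<bar>n - m\<bar> \<le> \<sigma> ^ nat \<bar>n\<bar>"
    using \<sigma>_pos \<sigma>_less_1 by (simp add: power_decreasing flip: power_add)
  then have weight: "\<sigma> ^ nat \<bar>m\<bar> \<le> \<sigma> ^ nat \<bar>n\<bar> / \<sigma> ^ nat \<bar>n - m\<bar>"
    using \<sigma>_pos by (simp add: field_simps)
  have "\<bar>k * seq x m\<bar> \<le> (C * \<rho> ^ nat \<bar>n - m\<bar>) * (norm x * \<sigma> ^ nat \<bar>m\<bar>)"
    unfolding abs_mult by (intro mult_mono assms abs_seq_le nonneg) auto
  also have "\<dots> \<le> (C * \<rho> ^ nat \<bar>n - m\<bar>) * (norm x * (\<sigma> ^ nat \<bar>n\<bar> / \<sigma> ^ nat \<bar>n - m\<bar>))"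
    by (intro mult_left_mono weight nonneg) auto
  also have "\<dots> = (norm x * C * \<sigma> ^ nat \<bar>n\<bar>) * (\<rho> / \<sigma>) ^ nat \<bar>m - n\<bar>"
    by (simp add: power_divide abs_minus_commute)
  finally show ?thesis .
qed

lemma kernel_op:
  assumes "exp_kernel K"
  shows summable_on_kernel: "(\<lambda>m. K n m * seq x m) summable_on UNIV"
    and seq_kernel_op: "seq (kernel_op K x) n = (\<Sum>\<^sub>\<infinity>m. K n m * seq x m)"
proof -
  obtain \<rho> C where \<rho>_bounds: "0 < \<rho>" "\<rho> < \<sigma>" and K_bound: "\<And>n m. \<bar>K n m\<bar> \<le> C * \<rho> ^ nat \<bar>n - m\<bar>"
    using assms unfolding exp_kernel_def by blast
  define A where "A = (\<Sum>\<^sub>\<infinity>m::int. (\<rho> / \<sigma>) ^ nat \<bar>m\<bar>)"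
  have ratio: "((\<lambda>m. c * (\<rho> / \<sigma>) ^ nat \<bar>m - n\<bar>) has_sum c * A) UNIV" for c and n :: int
  proof (intro has_sum_cmult_right)
    have bij: "bij_betw (\<lambda>m::int. m - n) UNIV UNIV" by (rule bij_betwI[of _ _ _ "\<lambda>m. m + n"]) auto
    have "((\<lambda>m::int. (\<rho> / \<sigma>) ^ nat \<bar>m\<bar>) has_sum A) UNIV"
      unfolding A_def using \<rho>_bounds
      by (intro has_sum_infsum summable_on_geometric_int) (auto simp: field_simps)
    then show "((\<lambda>m. (\<rho> / \<sigma>) ^ nat \<bar>m - n\<bar>) has_sum A) UNIV"
      using has_sum_reindex_bij_betw[OF bij, of "\<lambda>m. (\<rho> / \<sigma>) ^ nat \<bar>m\<bar>"] by simp
  qed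
  note bound = kernel_term_bound[OF K_bound]
  show summable: "(\<lambda>m. K n m * seq x m) summable_on UNIV" for n x
    by (rule abs_summable_summable[OF
          Infinite_Sum.abs_summable_on_comparison_test'[OF has_sum_imp_summable[OF ratio]]])
      (use bound in auto)
  have "\<bar>\<Sum>\<^sub>\<infinity>m. K n m * seq x m\<bar> \<le> norm x * (C * A) * \<sigma> ^ nat \<bar>n\<bar>" for n x
  proof -
    have "norm (\<Sum>\<^sub>\<infinity>m. K n m * seq x m) \<le> norm x * C * \<sigma> ^ nat \<bar>n\<bar> * A"
      by (rule norm_infsum_le[OF has_sum_infsum[OF summable] ratio]) (use bound in auto)
    then show ?thesis by (simp add: mult_ac)
  qed
  then have "seq (kernel_op K x) = (\<lambda>n. \<Sum>\<^sub>\<infinity>m. K n m * seq x m)" for x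
    unfolding kernel_op_def
    by (intro seq_operator[where C = "C * A"])
      (simp_all add: distrib_left infsum_add summable mult.left_commute infsum_cmult_right')
  then show "seq (kernel_op K x) n = (\<Sum>\<^sub>\<infinity>m. K n m * seq x m)" by simp
qed

lemma seq_kernel_op_first_order:
  assumes "exp_kernel K"
  shows "seq (kernel_op K x) n - a * seq (kernel_op K x) n'
      = (\<Sum>\<^sub>\<infinity>m. (K n m - a * K n' m) * seq x m)"
proof -
  have "(\<Sum>\<^sub>\<infinity>m. (K n m - a * K n' m) * seq x m) = (\<Sum>\<^sub>\<infinity>m. K n m * seq x m + - a * (K n' m * seq x m))"
    by (intro infsum_cong) (simp add: algebra_simps)
  also have "\<dots> = (\<Sum>\<^sub>\<infinity>m. K n m * seq x m) + (\<Sum>\<^sub>\<infinity>m. - a * (K n' m * seq x m))"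
    using assms by (intro infsum_add summable_on_cmult_right summable_on_kernel)
  also have "\<dots> = (\<Sum>\<^sub>\<infinity>m. K n m * seq x m) - a * (\<Sum>\<^sub>\<infinity>m. K n' m * seq x m)"
    unfolding infsum_cmult_right' by simp
  finally show ?thesis using assms by (simp add: seq_kernel_op)
qed

definition localized :: "(int \<Rightarrow> real) \<Rightarrow> bool" where
  "localized \<omega> \<longleftrightarrow> (\<exists>x y. x < \<sigma> \<and> 1 / \<sigma> < y \<and> two_sided_geometric x y \<omega>)"

definition expanding :: "(int \<Rightarrow> real) \<Rightarrow> bool" where
  "expanding \<omega> \<longleftrightarrow> (\<exists>x y. 1 / \<sigma> < x \<and> 1 / \<sigma> < y \<and> two_sided_geometric x y \<omega>)"

lemma localized_pos: "localized \<omega> \<Longrightarrow> 0 < \<omega> n"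
  and expanding_pos: "expanding \<omega> \<Longrightarrow> 0 < \<omega> n"
  by (auto simp: localized_def expanding_def two_sided_geometric_def)

lemma localized_ratio_le:
  assumes "localized \<omega>"
  obtains \<rho> C where "0 < \<rho>" "\<rho> < \<sigma>" "0 \<le> C"
    "\<And>m n. 0 \<le> m \<and> m \<le> n \<or> n \<le> m \<and> m \<le> 0 \<Longrightarrow> \<omega> n / \<omega> m \<le> C * \<rho> ^ nat \<bar>n - m\<bar>"
proof -
  obtain x y where rates: "x < \<sigma>" "1 / \<sigma> < y" and geom: "two_sided_geometric x y \<omega>"
    using assms unfolding localized_def by blast
  then have pos: "0 < x" "0 < y" by (auto simp: two_sided_geometric_def)
  obtain C where ratio_le: "0 \<le> C"
    "\<And>m n. \<omega> n / \<omega> m \<le> C * (two_sided_power x y n / two_sided_power x y m)"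
    using two_sided_geometric_ratio_le[OF geom] by blast
  define \<rho> where "\<rho> = max x (1 / y)"
  have "\<omega> n / \<omega> m \<le> C * \<rho> ^ nat \<bar>n - m\<bar>" if "0 \<le> m \<and> m \<le> n \<or> n \<le> m \<and> m \<le> 0" for m n
  proof -
    have "two_sided_power x y n / two_sided_power x y m \<le> \<rho> ^ nat \<bar>n - m\<bar>"
      using pos that by (intro two_sided_power_divide_le) (auto simp: \<rho>_def)
    then show ?thesis using ratio_le(2)[of n m] mult_left_mono[OF _ ratio_le(1)] order_trans
      by blast
  qed
  moreover have "0 < \<rho>" "\<rho> < \<sigma>"
    using rates pos \<sigma>_pos by (auto simp: \<rho>_def field_simps less_max_iff_disj)
  ultimately show ?thesis using that ratio_le(1) by blast
qed

lemma localized_exp_bounded: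
  assumes "localized \<omega>"
  shows "exp_bounded \<omega>"
proof -
  obtain \<rho> C where \<rho>_bounds: "0 < \<rho>" "\<rho> < \<sigma>" "0 \<le> C" and
    ratio: "\<And>m n. 0 \<le> m \<and> m \<le> n \<or> n \<le> m \<and> m \<le> 0 \<Longrightarrow> \<omega> n / \<omega> m \<le> C * \<rho> ^ nat \<bar>n - m\<bar>"
    using localized_ratio_le[OF assms] by blast
  have "\<bar>\<omega> n\<bar> \<le> (\<omega> 0 * C) * \<sigma> ^ nat \<bar>n\<bar>" for n
  proof -
    have "\<omega> n / \<omega> 0 \<le> C * \<rho> ^ nat \<bar>n\<bar>" using ratio[of 0 n] by (cases "0 \<le> n") auto
    also have "\<dots> \<le> C * \<sigma> ^ nat \<bar>n\<bar>" using \<rho>_bounds by (intro mult_left_mono power_mono) auto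
    finally show ?thesis
      using localized_pos[OF assms, of 0] localized_pos[OF assms, of n] by (simp add: field_simps)
  qed
  then show ?thesis unfolding exp_bounded_def by blast
qed

definition localized_kernel :: "(int \<Rightarrow> real) \<Rightarrow> int \<Rightarrow> int \<Rightarrow> real" where
  "localized_kernel \<omega> n m = \<omega> n / \<omega> m *
     (if 1 \<le> m \<and> m \<le> n then 1 else if n < m \<and> m \<le> 0 then -1 else 0)"

definition expanding_kernel :: "(int \<Rightarrow> real) \<Rightarrow> int \<Rightarrow> int \<Rightarrow> real" where
  "expanding_kernel \<omega> n m = (if n < m then - (\<omega> n / \<omega> m) else 0)"

lemma exp_kernel_localized:
  assumes "localized \<omega>"
  shows "exp_kernel (localized_kernel \<omega>)"
proof -
  obtain \<rho> C where \<rho>_bounds: "0 < \<rho>" "\<rho> < \<sigma>" "0 \<le> C" and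
    ratio: "\<And>m n. 0 \<le> m \<and> m \<le> n \<or> n \<le> m \<and> m \<le> 0 \<Longrightarrow> \<omega> n / \<omega> m \<le> C * \<rho> ^ nat \<bar>n - m\<bar>"
    using localized_ratio_le[OF assms] by blast
  have "\<bar>localized_kernel \<omega> n m\<bar> \<le> C * \<rho> ^ nat \<bar>n - m\<bar>" for n m
    using ratio[of m n] \<rho>_bounds localized_pos[OF assms, of n] localized_pos[OF assms, of m]
    by (auto simp: localized_kernel_def abs_mult)
  then show ?thesis unfolding exp_kernel_def using \<rho>_bounds by blast
qed

lemma exp_kernel_expanding:
  assumes "expanding (\<lambda>n. \<bar>\<omega> n\<bar>)"
  shows "exp_kernel (expanding_kernel \<omega>)"
proof -
  obtain x y where rates: "1 / \<sigma> < x" "1 / \<sigma> < y" and geom: "two_sided_geometric x y (\<lambda>n. \<bar>\<omega> n\<bar>)"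
    using assms unfolding expanding_def by blast
  then have pos: "0 < x" "0 < y" by (auto simp: two_sided_geometric_def)
  obtain C where ratio_le: "0 \<le> C"
    "\<And>m n. \<bar>\<omega> n\<bar> / \<bar>\<omega> m\<bar> \<le> C * (two_sided_power x y n / two_sided_power x y m)"
    using two_sided_geometric_ratio_le[OF geom] by blast
  define \<rho> where "\<rho> = max (1 / x) (1 / y)"
  have \<rho>_bounds: "0 < \<rho>" "\<rho> < \<sigma>" "1 \<le> \<rho> * x" "1 \<le> \<rho> * y"
    using rates pos \<sigma>_pos by (auto simp: \<rho>_def field_simps less_max_iff_disj max_def)
  have "\<bar>expanding_kernel \<omega> n m\<bar> \<le> C * \<rho> ^ nat \<bar>n - m\<bar>" for n m
  proof (cases "n < m")
    case True
    have "0 < two_sided_power x y m" using pos by (simp add: two_sided_power_def)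
    then have "two_sided_power x y n / two_sided_power x y m \<le> \<rho> ^ nat \<bar>n - m\<bar>"
      using two_sided_power_le_growth[OF pos \<rho>_bounds(1,3,4), of n m] True
      by (simp add: divide_le_eq)
    then have "C * (two_sided_power x y n / two_sided_power x y m) \<le> C * \<rho> ^ nat \<bar>n - m\<bar>"
      by (rule mult_left_mono[OF _ ratio_le(1)])
    then show ?thesis using ratio_le(2)[of n m] True by (simp add: expanding_kernel_def)
  qed (use ratio_le \<rho>_bounds in \<open>simp add: expanding_kernel_def\<close>)
  then show ?thesis unfolding exp_kernel_def using \<rho>_bounds by blast
qed

lemma seq_kernel_op_inverse:
  assumes "exp_kernel K" "\<And>m. K n m - a * K n' m = (if m = n then 1 else 0)"
  shows "seq (kernel_op K h) n - a * seq (kernel_op K h) n' = seq h n"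
  by (simp only: seq_kernel_op_first_order[OF assms(1)] assms(2) infsum_delta_mult)

lemma localized_green:
  fixes \<omega> defines "G \<equiv> kernel_op (localized_kernel \<omega>)"
  assumes "localized \<omega>"
  shows "seq (G h) n - \<omega> n / \<omega> (n - 1) * seq (G h) (n - 1) = seq h n"
  unfolding G_def
proof (rule seq_kernel_op_inverse)
  have "\<omega> k \<noteq> 0" for k using localized_pos[OF assms(2), of k] by simp
  then show "localized_kernel \<omega> n m - \<omega> n / \<omega> (n - 1) * localized_kernel \<omega> (n - 1) m
      = (if m = n then 1 else 0)" for m
    by (auto simp: localized_kernel_def)
qed (rule exp_kernel_localized[OF assms(2)])

text \<open>The transposed kernel leaves a defect at the site \<open>0\<close>, which vanishes on the annihilator
  of \<open>\<omega>\<close>.\<close>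

lemma localized_green_transpose:
  fixes \<omega> defines "G \<equiv> kernel_op (\<lambda>n m. localized_kernel \<omega> m n)"
  assumes localized: "localized \<omega>" and annihilated: "pairing \<omega> h = 0"
  shows "seq (G h) n - \<omega> (n + 1) / \<omega> n * seq (G h) (n + 1) = seq h n"
proof -
  have nonzero: "\<omega> k \<noteq> 0" for k using localized_pos[OF localized, of k] by simp
  define e where "e = (if n = 0 then 1 / \<omega> 0 else 0)"
  have "(localized_kernel \<omega> m n - \<omega> (n + 1) / \<omega> n * localized_kernel \<omega> m (n + 1)) * seq h m
      = (if m = n then 1 else 0) * seq h m + - e * (\<omega> m * seq h m)" for m
    using nonzero by (auto simp: localized_kernel_def e_def)
  then have "seq (G h) n - \<omega> (n + 1) / \<omega> n * seq (G h) (n + 1)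
      = (\<Sum>\<^sub>\<infinity>m. (if m = n then 1 else 0) * seq h m + - e * (\<omega> m * seq h m))"
    unfolding G_def
    by (simp only: seq_kernel_op_first_order[OF
          exp_kernel_transpose[OF exp_kernel_localized[OF localized]]])
  also have "\<dots> = (\<Sum>\<^sub>\<infinity>m. (if m = n then 1 else 0) * seq h m) + (\<Sum>\<^sub>\<infinity>m. - e * (\<omega> m * seq h m))"
  proof (rule infsum_add)
    show "(\<lambda>m. (if m = n then 1 else 0) * seq h m) summable_on UNIV"
      by (rule summable_on_cong_neutral[THEN iffD1, of _ "{n}"]) auto
    show "(\<lambda>m. - e * (\<omega> m * seq h m)) summable_on UNIV"
      by (intro summable_on_cmult_right summable_on_pairing localized_exp_bounded localized)
  qed
  also have "\<dots> = seq h n + - e * pairing \<omega> h"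
    by (simp only: infsum_delta_mult infsum_cmult_right'
        pairing_apply[OF localized_exp_bounded[OF localized]])
  finally show ?thesis by (simp add: annihilated)
qed

lemma expanding_green:
  fixes \<omega> defines "G \<equiv> kernel_op (expanding_kernel \<omega>)"
  assumes "expanding (\<lambda>n. \<bar>\<omega> n\<bar>)"
  shows "seq (G h) n - \<omega> n / \<omega> (n - 1) * seq (G h) (n - 1) = seq h n"
  unfolding G_def
proof (rule seq_kernel_op_inverse)
  have "\<omega> k \<noteq> 0" for k using expanding_pos[OF assms(2), of k] by simp
  then show "expanding_kernel \<omega> n m - \<omega> n / \<omega> (n - 1) * expanding_kernel \<omega> (n - 1) m
      = (if m = n then 1 else 0)" for m
    by (auto simp: expanding_kernel_def)
qed (rule exp_kernel_expanding[OF assms(2)])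

lemma expanding_green_transpose:
  fixes \<omega> defines "G \<equiv> kernel_op (\<lambda>n m. expanding_kernel \<omega> m n)"
  assumes "expanding (\<lambda>n. \<bar>\<omega> n\<bar>)"
  shows "seq (G h) n - \<omega> (n + 1) / \<omega> n * seq (G h) (n + 1) = seq h n"
  unfolding G_def
proof (rule seq_kernel_op_inverse)
  have "\<omega> k \<noteq> 0" for k using expanding_pos[OF assms(2), of k] by simp
  then show "expanding_kernel \<omega> m n - \<omega> (n + 1) / \<omega> n * expanding_kernel \<omega> m (n + 1)
      = (if m = n then 1 else 0)" for m
    by (auto simp: expanding_kernel_def)
qed (rule exp_kernel_transpose[OF exp_kernel_expanding[OF assms(2)]])

end

section \<open>Zero modes at the interface\<close>

lemma int_recurrence_exists:
  fixes r :: "int \<Rightarrow> real"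
  assumes r_nonzero: "\<And>n. r n \<noteq> 0"
  obtains \<omega> where "\<And>n. \<omega> n \<noteq> 0" "\<And>n. \<omega> (n + 1) = r n * \<omega> n"
proof
  define \<omega> where
    "\<omega> n = (if n \<ge> 0 then \<Prod>i<nat n. r (int i) else 1 / (\<Prod>i<nat (- n). r (- 1 - int i)))" for n
  show "\<omega> n \<noteq> 0" for n using r_nonzero by (auto simp: \<omega>_def)
  show "\<omega> (n + 1) = r n * \<omega> n" for n
  proof (cases "n \<ge> 0")
    case True
    then have "nat (n + 1) = Suc (nat n)" by linarith
    then show ?thesis using True by (simp add: \<omega>_def mult.commute)
  next
    case False
    define k where "k = nat (- n - 1)"
    have k_eq: "nat (- n) = Suc k" "n = - 1 - int k" using False by (auto simp: k_def)
    have "\<omega> n = 1 / (\<Prod>i<Suc k. r (- 1 - int i))" using False by (simp only: \<omega>_def k_eq(1) if_False)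
    moreover have "\<omega> (n + 1) = 1 / (\<Prod>i<k. r (- 1 - int i))"
      by (cases "k = 0") (auto simp: \<omega>_def k_eq(2))
    ultimately show ?thesis using r_nonzero[of n] by (simp add: k_eq(2))
  qed
qed

fun two_term_recurrence :: "(nat \<Rightarrow> real) \<Rightarrow> (nat \<Rightarrow> real) \<Rightarrow> real \<Rightarrow> real \<Rightarrow> nat \<Rightarrow> real" where
  "two_term_recurrence \<alpha> \<beta> u v 0 = u"
| "two_term_recurrence \<alpha> \<beta> u v (Suc 0) = v"
| "two_term_recurrence \<alpha> \<beta> u v (Suc (Suc k)) =
     \<alpha> k * two_term_recurrence \<alpha> \<beta> u v k + \<beta> k * two_term_recurrence \<alpha> \<beta> u v (Suc k)"

lemma two_term_recurrence_pos:
  assumes "\<And>k. 0 < \<alpha> k" "\<And>k. 0 < \<beta> k" "0 < u" "0 < v"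
  shows "0 < two_term_recurrence \<alpha> \<beta> u v k"
  using assms by (induction \<alpha> \<beta> u v k rule: two_term_recurrence.induct) (auto intro!: add_pos_pos)

lemma backward_recurrence_exists:
  fixes \<alpha> \<beta> :: "int \<Rightarrow> real"
  assumes "\<And>n. 0 < \<alpha> n" "\<And>n. 0 < \<beta> n" "0 < u" "0 < v"
  obtains \<omega> where "\<omega> 1 = u" "\<omega> 0 = v" "\<And>n. 0 < \<omega> n"
    "\<And>n. n \<le> 1 \<Longrightarrow> \<omega> (n - 2) = \<alpha> n * \<omega> n + \<beta> n * \<omega> (n - 1)"
proof
  define \<omega> where
    "\<omega> n = two_term_recurrence (\<lambda>k. \<alpha> (1 - int k)) (\<lambda>k. \<beta> (1 - int k)) u v (nat (1 - n))" for n
  show "\<omega> 1 = u" "\<omega> 0 = v" by (simp_all add: \<omega>_def)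
  show "0 < \<omega> n" for n unfolding \<omega>_def using assms by (intro two_term_recurrence_pos) auto
  show "\<omega> (n - 2) = \<alpha> n * \<omega> n + \<beta> n * \<omega> (n - 1)" if "n \<le> 1" for n
  proof -
    define k where "k = nat (1 - n)"
    have "n = 1 - int k" using that by (simp add: k_def)
    then have "nat (1 - n) = k" "nat (1 - (n - 1)) = Suc k" "nat (1 - (n - 2)) = Suc (Suc k)"
      by simp_all
    then show ?thesis using \<open>n = 1 - int k\<close> by (simp add: \<omega>_def)
  qed
qed

text \<open>The growth rates of even zero modes in a bulk with ratio \<open>r = (b + \<delta>) / b\<close> of the
  coefficients.\<close>

definition even_rate :: "real \<Rightarrow> real" where
  "even_rate r = (sqrt (r\<^sup>2 + 8 / r) - r) / 2"

lemma even_rate: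
  assumes "0 < r"
  shows even_rate_pos: "0 < even_rate r"
    and even_rate_quadratic: "(even_rate r)\<^sup>2 + r * even_rate r = 2 / r"
proof -
  have "sqrt (r\<^sup>2) < sqrt (r\<^sup>2 + 8 / r)" using assms by (intro real_sqrt_less_mono) simp
  then show "0 < even_rate r" using assms by (simp add: even_rate_def)
  have "(sqrt (r\<^sup>2 + 8 / r))\<^sup>2 = r\<^sup>2 + 8 / r" using assms by simp
  then show "(even_rate r)\<^sup>2 + r * even_rate r = 2 / r"
    unfolding even_rate_def by (simp add: field_simps power2_eq_square)
qed

lemma divide_even_rate: "0 < r \<Longrightarrow> 2 / r / even_rate r = even_rate r + r"
  using even_rate_pos[of r] by (simp add: power2_eq_square field_simps flip: even_rate_quadratic)

lemma even_rate_less_1: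
  assumes "1 < r"
  shows "even_rate r < 1"
proof (rule ccontr)
  assume "\<not> even_rate r < 1"
  then have "1 * 1 + r * 1 \<le> even_rate r * even_rate r + r * even_rate r"
    using assms by (intro add_mono mult_mono) auto
  moreover have "2 / r < 2" using assms by (simp add: field_simps)
  ultimately show False using even_rate_quadratic[of r] assms by (simp add: power2_eq_square)
qed

lemma even_rate_greater_1:
  assumes "0 < r" "r < 1"
  shows "1 < even_rate r"
proof (rule ccontr)
  assume "\<not> 1 < even_rate r"
  then have "even_rate r * even_rate r + r * even_rate r \<le> 1 * 1 + r * 1"
    using assms even_rate_pos[of r] by (intro add_mono mult_mono) auto
  moreover have "2 < 2 / r" using assms by (simp add: field_simps)
  ultimately show False using even_rate_quadratic[of r] assms by (simp add: power2_eq_square)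
qed

locale interface =
  fixes bp bm dp dm cc :: real
  assumes bp_pos: "0 < bp" and bm_pos: "0 < bm" and dp_pos: "0 < dp" and dm_neg: "dm < 0"
    and bm_dm_pos: "0 < bm + dm" and cc_pos: "0 < cc"
begin

definition b :: "int \<Rightarrow> real" where
  "b n = (if n \<ge> 0 then bp else bm)"

definition c :: "int \<Rightarrow> real" where
  "c n = (if n \<ge> 0 then bp + dp else if n = -1 then cc else bm + dm)"

definition d :: "int \<Rightarrow> real" where
  "d n = (if n \<ge> 0 then bp + dp else if n = -1 \<or> n = -2 then cc else bm + dm)"

lemma coeff_pos: "0 < b n" "0 < c n" "0 < d n"
  using bp_pos bm_pos dp_pos bm_dm_pos cc_pos by (auto simp: b_def c_def d_def)

lemma coeff_nonzero [simp]: "b n \<noteq> 0" "c n \<noteq> 0" "d n \<noteq> 0"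
  using coeff_pos[of n] by simp_all

lemma bounded_coeff [simp]:
  "bounded (range b)" "bounded (range c)" "bounded (range d)"
  "bounded (range (\<lambda>n. c (n - 1)))" "bounded (range (\<lambda>n. d (n - 2)))"
  "bounded (range (\<lambda>n. 1 / b n))" "bounded (range (\<lambda>n. 1 / c n))" "bounded (range (\<lambda>n. 1 / d n))"
  "bounded (range (\<lambda>n. 1 / c (n - 1)))" "bounded (range (\<lambda>n. 1 / d (n - 2)))"
proof -
  define S where "S = {bp, bm, bp + dp, bm + dm, cc}"
  have "bounded (range a)" if "range a \<subseteq> S \<union> (\<lambda>x. 1 / x) ` S" for a :: "int \<Rightarrow> real"
    using that by (rule bounded_subset[OF finite_imp_bounded, rotated]) (simp add: S_def)
  note bounded = this
  show "bounded (range b)" "bounded (range c)" "bounded (range d)"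
    "bounded (range (\<lambda>n. c (n - 1)))" "bounded (range (\<lambda>n. d (n - 2)))"
    "bounded (range (\<lambda>n. 1 / b n))" "bounded (range (\<lambda>n. 1 / c n))" "bounded (range (\<lambda>n. 1 / d n))"
    "bounded (range (\<lambda>n. 1 / c (n - 1)))" "bounded (range (\<lambda>n. 1 / d (n - 2)))"
    by (rule bounded; auto simp: b_def c_def d_def S_def)+
qed

definition rp :: real where "rp = (bp + dp) / bp"
definition rm :: real where "rm = (bm + dm) / bm"

lemma ratio_bounds: "0 < rp" "1 < rp" "0 < rm" "rm < 1"
  using bp_pos bm_pos dp_pos dm_neg bm_dm_pos by (auto simp: rp_def rm_def field_simps)

definition odd_zero_mode :: "(int \<Rightarrow> real) \<Rightarrow> bool" where
  "odd_zero_mode f \<longleftrightarrow> (\<forall>n. c n * f (n + 1) = b n * f n)"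

definition even_zero_mode :: "(int \<Rightarrow> real) \<Rightarrow> bool" where
  "even_zero_mode P \<longleftrightarrow>
     (\<forall>n. b n * P n + c (n - 1) * P (n - 1) = 2 * b n * b (n - 2) / d (n - 2) * P (n - 2))"

text \<open>\<open>even_cofactor P W\<close> says that \<open>W\<close> is annihilated by the other factor of the even operator,
  whose right factor annihilates \<open>P\<close>.\<close>

definition even_cofactor :: "(int \<Rightarrow> real) \<Rightarrow> (int \<Rightarrow> real) \<Rightarrow> bool" where
  "even_cofactor P W \<longleftrightarrow>
     (\<forall>n. W n / W (n - 1) = - (2 * b (n - 2) / d (n - 2) * P (n - 2) / P (n - 1)))"

lemma odd_zero_mode_exists:
  obtains f where "odd_zero_mode f" "two_sided_geometric (1 / rp) (1 / rm) f"
proof -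
  obtain g where g_rec: "\<And>n. g n \<noteq> 0" "\<And>n. g (n + 1) = b n / c n * g n"
    using int_recurrence_exists[of "\<lambda>n. b n / c n"] by auto
  define f where "f n = \<bar>g n\<bar>" for n
  have f_rec: "0 < f n" "f (n + 1) = b n / c n * f n" for n
    using g_rec coeff_pos[of n] by (auto simp: f_def abs_mult)
  have "f (n + 1) = 1 / rp * f n" if "0 \<le> n" for n
    using f_rec(2)[of n] that bp_pos by (simp add: b_def c_def rp_def)
  then have top: "f \<in> \<Theta>[at_top](\<lambda>n. (1 / rp) powi n)"
    using ratio_bounds f_rec(1)[of 0] by (intro bigtheta_at_top_if_ratio[where N = 0]) auto
  have "f (n + 1) = 1 / rm * f n" if "n < - 1" for n
    using f_rec(2)[of n] that bm_pos by (simp add: b_def c_def rm_def)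
  then have bot: "f \<in> \<Theta>[at_bot](\<lambda>n. (1 / rm) powi n)"
    using ratio_bounds f_rec(1)[of "- 1"] by (intro bigtheta_at_bot_if_ratio[where N = "- 1"]) auto
  show ?thesis
  proof
    show "odd_zero_mode f" using f_rec(2) by (simp add: odd_zero_mode_def)
    show "two_sided_geometric (1 / rp) (1 / rm) f"
      using ratio_bounds f_rec(1) top bot by (simp add: two_sided_geometric_def)
  qed
qed

lemma even_bulk_solution:
  assumes "2 \<le> n" and u_eq: "u = even_rate rp"
  shows "b n * u powi n + c (n - 1) * u powi (n - 1)
      = 2 * b n * b (n - 2) / d (n - 2) * u powi (n - 2)"
proof -
  have "0 < u" "u\<^sup>2 + rp * u = 2 / rp" using even_rate[of rp] ratio_bounds by (simp_all add: u_eq)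
  then have powers: "u powi n = u powi (n - 2) * u\<^sup>2" "u powi (n - 1) = u powi (n - 2) * u"
    by (simp_all add: power_int_diff power2_eq_square)
  have "bp * u\<^sup>2 + (bp + dp) * u = bp * (u\<^sup>2 + rp * u)"
    using bp_pos by (simp add: rp_def field_simps)
  also have "\<dots> = 2 * bp * bp / (bp + dp)"
    unfolding \<open>u\<^sup>2 + rp * u = 2 / rp\<close> using bp_pos dp_pos by (simp add: rp_def)
  finally have "u powi (n - 2) * (bp * u\<^sup>2 + (bp + dp) * u)
      = u powi (n - 2) * (2 * bp * bp / (bp + dp))" by simp
  then show ?thesis
    unfolding powers using assms(1) by (simp add: b_def c_def d_def algebra_simps)
qed

lemma even_recurrence_iff:
  "b n * x + c (n - 1) * y = 2 * b n * b (n - 2) / d (n - 2) * z \<longleftrightarrow>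
     z = d (n - 2) / (2 * b (n - 2)) * x + c (n - 1) * d (n - 2) / (2 * b n * b (n - 2)) * y"
  by (auto simp: field_simps)

lemma even_zero_mode_bigtheta_at_bot:
  assumes "even_zero_mode P" "\<And>n. 0 < P n"
  shows "P \<in> \<Theta>[at_bot](\<lambda>n. even_rate rm powi n)"
proof (rule bigtheta_at_bot_if_two_term_recurrence[OF assms(2)])
  have "P (n - 2) = d (n - 2) / (2 * b (n - 2)) * P n
      + c (n - 1) * d (n - 2) / (2 * b n * b (n - 2)) * P (n - 1)" for n
    using assms(1) unfolding even_zero_mode_def even_recurrence_iff by blast
  then show "P (n - 2) = rm / 2 * P n + rm\<^sup>2 / 2 * P (n - 1)" if "n \<le> - 1" for n
    using that by (simp add: b_def c_def d_def rm_def power2_eq_square)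
  have "rm / 2 * (even_rate rm)\<^sup>2 + rm\<^sup>2 / 2 * even_rate rm
      = rm / 2 * ((even_rate rm)\<^sup>2 + rm * even_rate rm)"
    by (simp add: algebra_simps power2_eq_square)
  then show "rm / 2 * (even_rate rm)\<^sup>2 + rm\<^sup>2 / 2 * even_rate rm = 1"
    using ratio_bounds by (simp add: even_rate_quadratic)
qed (use ratio_bounds even_rate_pos in auto)

lemma even_zero_mode_exists:
  obtains P where "even_zero_mode P" "two_sided_geometric (even_rate rp) (even_rate rm) P"
proof -
  define u where "u = even_rate rp"
  have u_pos: "0 < u" using even_rate_pos[of rp] ratio_bounds by (simp add: u_def)
  define \<alpha> where "\<alpha> n = d (n - 2) / (2 * b (n - 2))" for n
  define \<beta> where "\<beta> n = c (n - 1) * d (n - 2) / (2 * b n * b (n - 2))" for n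
  have "0 < \<alpha> n" "0 < \<beta> n" for n using coeff_pos by (simp_all add: \<alpha>_def \<beta>_def)
  then obtain \<omega> where \<omega>_rec: "\<omega> 1 = u" "\<omega> 0 = 1" "\<And>n. 0 < \<omega> n"
    "\<And>n. n \<le> 1 \<Longrightarrow> \<omega> (n - 2) = \<alpha> n * \<omega> n + \<beta> n * \<omega> (n - 1)"
    using backward_recurrence_exists[of \<alpha> \<beta> u 1] u_pos by (metis zero_less_one)
  define P where "P n = (if 0 \<le> n then u powi n else \<omega> n)" for n
  have P_pos: "0 < P n" for n using u_pos \<omega>_rec(3) by (simp add: P_def)
  have P_eq_\<omega>: "P n = \<omega> n" if "n \<le> 1" for n
    using that \<omega>_rec(1,2) by (cases "n = 1"; cases "n = 0") (auto simp: P_def)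
  have even: "even_zero_mode P"
    unfolding even_zero_mode_def
  proof
    show "b n * P n + c (n - 1) * P (n - 1) = 2 * b n * b (n - 2) / d (n - 2) * P (n - 2)" for n
    proof (cases "2 \<le> n")
      case True
      then show ?thesis using even_bulk_solution[OF True u_def] by (simp add: P_def)
    next
      case False
      then show ?thesis
        unfolding even_recurrence_iff using \<omega>_rec(4)[of n] by (simp add: P_eq_\<omega> \<alpha>_def \<beta>_def)
    qed
  qed
  have "P (n + 1) = u * P n" if "0 \<le> n" for n
    using that u_pos by (simp add: P_def power_int_add)
  then have "P \<in> \<Theta>[at_top](\<lambda>n. u powi n)"
    using u_pos P_pos[of 0] by (intro bigtheta_at_top_if_ratio[where N = 0]) auto
  then have "two_sided_geometric (even_rate rp) (even_rate rm) P"
    using ratio_bounds even_rate_pos P_pos even_zero_mode_bigtheta_at_bot[OF even]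
    by (simp add: two_sided_geometric_def u_def)
  then show ?thesis by (rule that[OF even])
qed

lemma even_cofactor_exists:
  assumes geometric_P: "two_sided_geometric (even_rate rp) (even_rate rm) P"
  obtains W where "even_cofactor P W"
    "two_sided_geometric (even_rate rp + rp) (even_rate rm + rm) (\<lambda>n. \<bar>W n\<bar>)"
proof -
  have P_pos: "0 < P n" for n using geometric_P by (simp add: two_sided_geometric_def)
  obtain B where B_rec: "\<And>n. B n \<noteq> 0" "\<And>n. B (n + 1) = - (2 * b (n - 1) / d (n - 1)) * B n"
    using int_recurrence_exists[of "\<lambda>n. - (2 * b (n - 1) / d (n - 1))"] by auto
  define W where "W n = B n / P (n + - 1)" for n
  have step: "\<bar>B (n + 1)\<bar> = 2 * b (n - 1) / d (n - 1) * \<bar>B n\<bar>" for n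
    unfolding B_rec(2) using coeff_pos[of "n - 1"] by (simp add: abs_mult)
  have "\<bar>B (n + 1)\<bar> = 2 / rp * \<bar>B n\<bar>" if "1 \<le> n" for n
    unfolding step using that by (simp add: b_def d_def rp_def)
  then have top: "(\<lambda>n. \<bar>B n\<bar>) \<in> \<Theta>[at_top](\<lambda>n. (2 / rp) powi n)"
    using ratio_bounds B_rec(1) by (intro bigtheta_at_top_if_ratio[where N = 1]) auto
  have "\<bar>B (n + 1)\<bar> = 2 / rm * \<bar>B n\<bar>" if "n < - 1" for n
    unfolding step using that by (simp add: b_def d_def rm_def)
  then have bot: "(\<lambda>n. \<bar>B n\<bar>) \<in> \<Theta>[at_bot](\<lambda>n. (2 / rm) powi n)"
    using ratio_bounds B_rec(1) by (intro bigtheta_at_bot_if_ratio[where N = "- 1"]) auto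
  have geometric_B: "two_sided_geometric (2 / rp) (2 / rm) (\<lambda>n. \<bar>B n\<bar>)"
    using ratio_bounds B_rec(1) top bot by (simp add: two_sided_geometric_def)
  show ?thesis
  proof
    have "B n / B (n - 1) = - (2 * b (n - 2) / d (n - 2))" for n
      using B_rec(2)[of "n - 1"] B_rec(1)[of "n - 1"] by (simp add: field_simps)
    moreover have "W n / W (n - 1) = (B n / B (n - 1)) * P (n - 2) / P (n - 1)" for n
      by (simp add: W_def)
    ultimately show "even_cofactor P W" by (simp add: even_cofactor_def)
    have "(\<lambda>n. \<bar>W n\<bar>) = (\<lambda>n. \<bar>B n\<bar> / P (n + - 1))"
      using P_pos by (auto simp: W_def abs_of_pos)
    moreover have "2 / rp / even_rate rp = even_rate rp + rp"
      "2 / rm / even_rate rm = even_rate rm + rm"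
      using ratio_bounds by (simp_all only: divide_even_rate)
    ultimately show "two_sided_geometric (even_rate rp + rp) (even_rate rm + rm) (\<lambda>n. \<bar>W n\<bar>)"
      using two_sided_geometric_divide[OF geometric_B
          two_sided_geometric_shift[OF geometric_P, of "- 1"]] by simp
  qed
qed

end

section \<open>The unperturbed operator and its Green operators\<close>

locale interface_modes = interface bp bm dp dm cc + exponential_weight \<sigma>
  for bp bm dp dm cc \<sigma> :: real +
  fixes f0 P0 W0 :: "int \<Rightarrow> real"
  assumes f0_localized: "localized f0" and f0_zero_mode: "odd_zero_mode f0"
    and P0_localized: "localized P0" and P0_zero_mode: "even_zero_mode P0"
    and W0_expanding: "expanding (\<lambda>n. \<bar>W0 n\<bar>)" and W0_cofactor: "even_cofactor P0 W0"
begin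

definition mult_b :: "sequence \<Rightarrow>\<^sub>L sequence" where
  "mult_b = shift_op b 0"

definition hop_c :: "sequence \<Rightarrow>\<^sub>L sequence" where
  "hop_c = shift_op c 1"

definition hop_c_adj :: "sequence \<Rightarrow>\<^sub>L sequence" where
  "hop_c_adj = shift_op (\<lambda>n. c (n - 1)) (- 1)"

definition hop_d :: "sequence \<Rightarrow>\<^sub>L sequence" where
  "hop_d = shift_op d 2"

definition hop_d_adj :: "sequence \<Rightarrow>\<^sub>L sequence" where
  "hop_d_adj = shift_op (\<lambda>n. d (n - 2)) (- 2)"

definition hop_d_inv :: "sequence \<Rightarrow>\<^sub>L sequence" where
  "hop_d_inv = shift_op (\<lambda>n. 1 / d (n - 2)) (- 2)"

definition hop_d_adj_inv :: "sequence \<Rightarrow>\<^sub>L sequence" where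
  "hop_d_adj_inv = shift_op (\<lambda>n. 1 / d n) 2"

lemma seq_coeff_op [simp]:
  "seq (mult_b x) n = b n * seq x n"
  "seq (hop_c x) n = c n * seq x (n + 1)" "seq (hop_c_adj x) n = c (n - 1) * seq x (n - 1)"
  "seq (hop_d x) n = d n * seq x (n + 2)" "seq (hop_d_adj x) n = d (n - 2) * seq x (n - 2)"
  "seq (hop_d_inv x) n = seq x (n - 2) / d (n - 2)" "seq (hop_d_adj_inv x) n = seq x (n + 2) / d n"
  by (simp_all add: mult_b_def hop_c_def hop_c_adj_def hop_d_def hop_d_adj_def hop_d_inv_def
      hop_d_adj_inv_def seq_shift_op)

lemma hop_d_hop_d_inv [simp]: "hop_d (hop_d_inv x) = x"
  and hop_d_adj_hop_d_adj_inv [simp]: "hop_d_adj (hop_d_adj_inv x) = x"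
  by (auto intro: seq_eqI)

definition odd_green :: "sequence \<Rightarrow>\<^sub>L sequence" where
  "odd_green = kernel_op (localized_kernel f0) o\<^sub>L shift_op (\<lambda>n. 1 / c (n - 1)) (- 1)"

definition odd_green_adj :: "sequence \<Rightarrow>\<^sub>L sequence" where
  "odd_green_adj = shift_op (\<lambda>n. 1 / c n) 1 o\<^sub>L kernel_op (\<lambda>n m. localized_kernel f0 m n)"

lemma f0_ratio: "f0 (n + 1) / f0 n = b n / c n"
proof -
  have "c n * f0 (n + 1) = b n * f0 n" using f0_zero_mode by (simp add: odd_zero_mode_def)
  then show ?thesis using localized_pos[OF f0_localized, of n] by (simp add: field_simps)
qed

lemma odd_green: "hop_c (odd_green h) - mult_b (odd_green h) = h"
proof (rule seq_eqI)
  fix n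
  have "seq (odd_green h) (n + 1) - b n / c n * seq (odd_green h) n = seq h n / c n"
    using localized_green[OF f0_localized, of "shift_op (\<lambda>n. 1 / c (n - 1)) (- 1) h" "n + 1"]
    by (simp add: odd_green_def f0_ratio seq_shift_op)
  then show "seq (hop_c (odd_green h) - mult_b (odd_green h)) n = seq h n"
    by (simp add: field_simps)
qed

lemma odd_green_adj:
  assumes "pairing f0 h = 0"
  shows "hop_c_adj (odd_green_adj h) - mult_b (odd_green_adj h) = h"
proof (rule seq_eqI)
  fix n
  define g where "g = kernel_op (\<lambda>n m. localized_kernel f0 m n) h"
  have "seq (odd_green_adj h) k = seq g (k + 1) / c k" for k
    by (simp add: odd_green_adj_def seq_shift_op g_def)
  then have "seq (hop_c_adj (odd_green_adj h) - mult_b (odd_green_adj h)) n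
      = seq g n - b n / c n * seq g (n + 1)"
    by simp
  then show "seq (hop_c_adj (odd_green_adj h) - mult_b (odd_green_adj h)) n = seq h n"
    using localized_green_transpose[OF f0_localized assms, of n] by (simp add: f0_ratio g_def)
qed

text \<open>Elimination of the amplitudes 2 and 5 leads to the even operator. It factors as
  \<open>b\<^sub>n (1 - \<theta>\<^sub>n S) (1 - \<phi>\<^sub>n S)\<close> with the backward shift \<open>S\<close> and the ratios
  \<open>\<phi>\<^sub>n = P0\<^sub>n / P0\<^sub>n\<^sub>-\<^sub>1\<close> and \<open>\<theta>\<^sub>n = W0\<^sub>n / W0\<^sub>n\<^sub>-\<^sub>1\<close>.\<close>

definition even_op :: "sequence \<Rightarrow>\<^sub>L sequence" where
  "even_op = mult_b + hop_c_adj - 2 *\<^sub>R (mult_b o\<^sub>L hop_d_inv o\<^sub>L mult_b)"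

definition even_op_adj :: "sequence \<Rightarrow>\<^sub>L sequence" where
  "even_op_adj = mult_b + hop_c - 2 *\<^sub>R (mult_b o\<^sub>L hop_d_adj_inv o\<^sub>L mult_b)"

definition even_green :: "sequence \<Rightarrow>\<^sub>L sequence" where
  "even_green = kernel_op (localized_kernel P0) o\<^sub>L kernel_op (expanding_kernel W0)
      o\<^sub>L shift_op (\<lambda>n. 1 / b n) 0"

definition even_green_adj :: "sequence \<Rightarrow>\<^sub>L sequence" where
  "even_green_adj = shift_op (\<lambda>n. 1 / b n) 0 o\<^sub>L kernel_op (\<lambda>n m. expanding_kernel W0 m n)
     o\<^sub>L kernel_op (\<lambda>n m. localized_kernel P0 m n)"

lemma seq_even_op:
  "seq (even_op x) n
      = b n * seq x n + c (n - 1) * seq x (n - 1) - 2 * b n * b (n - 2) / d (n - 2) * seq x (n - 2)"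
  "seq (even_op_adj x) n
      = b n * seq x n + c n * seq x (n + 1) - 2 * b n * b (n + 2) / d n * seq x (n + 2)"
  by (simp_all add: even_op_def even_op_adj_def blinfun.bilinear_simps)

lemma seq_div_b: "seq (shift_op (\<lambda>n. 1 / b n) 0 x) n = seq x n / b n"
  by (simp add: seq_shift_op)

lemma even_factorization:
  defines "\<phi> \<equiv> \<lambda>n. P0 n / P0 (n - 1)" and "\<theta> \<equiv> \<lambda>n. W0 n / W0 (n - 1)"
  shows "\<theta> n * \<phi> (n - 1) = - (2 * b (n - 2) / d (n - 2))" and "\<theta> n + \<phi> n = - (c (n - 1) / b n)"
proof -
  have nonzero: "P0 k \<noteq> 0" for k using localized_pos[OF P0_localized, of k] by simp
  have \<theta>_eq: "\<theta> n = - (2 * b (n - 2) / d (n - 2) * P0 (n - 2) / P0 (n - 1))"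
    using W0_cofactor by (simp add: even_cofactor_def \<theta>_def)
  show "\<theta> n * \<phi> (n - 1) = - (2 * b (n - 2) / d (n - 2))"
    unfolding \<theta>_eq using nonzero by (simp add: \<phi>_def diff_diff_eq)
  have "b n * P0 n + c (n - 1) * P0 (n - 1) = 2 * b n * b (n - 2) / d (n - 2) * P0 (n - 2)"
    using P0_zero_mode by (simp add: even_zero_mode_def)
  then have "2 * b (n - 2) / d (n - 2) * P0 (n - 2) = P0 n + c (n - 1) / b n * P0 (n - 1)"
    by (simp add: field_simps)
  then show "\<theta> n + \<phi> n = - (c (n - 1) / b n)"
    unfolding \<theta>_eq using nonzero[of "n - 1"] by (simp add: \<phi>_def add_divide_distrib)
qed

lemma even_green: "even_op (even_green h) = h"
proof (rule seq_eqI)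
  fix n
  define \<phi> where "\<phi> n = P0 n / P0 (n - 1)" for n
  define \<theta> where "\<theta> n = W0 n / W0 (n - 1)" for n
  define x where "x = seq (even_green h)"
  define y where "y = seq (kernel_op (expanding_kernel W0) (shift_op (\<lambda>n. 1 / b n) 0 h))"
  have y_eq: "x k - \<phi> k * x (k - 1) = y k" for k
    unfolding x_def y_def even_green_def \<phi>_def blinfun_apply_blinfun_compose
    by (rule localized_green[OF P0_localized])
  have "y n - \<theta> n * y (n - 1) = seq h n / b n"
    unfolding y_def \<theta>_def by (simp only: expanding_green[OF W0_expanding] seq_div_b)
  then have "b n * (x n - (\<theta> n + \<phi> n) * x (n - 1) + \<theta> n * \<phi> (n - 1) * x (n - 2)) = seq h n"
    unfolding y_eq[symmetric] by (simp add: field_simps)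
  then show "seq (even_op (even_green h)) n = seq h n"
    unfolding even_factorization[of n, folded \<phi>_def \<theta>_def]
    by (simp add: seq_even_op x_def algebra_simps)
qed

lemma even_green_adj:
  assumes "pairing P0 h = 0"
  shows "even_op_adj (even_green_adj h) = h"
proof (rule seq_eqI)
  fix n
  define \<phi> where "\<phi> n = P0 n / P0 (n - 1)" for n
  define \<theta> where "\<theta> n = W0 n / W0 (n - 1)" for n
  define y where "y = seq (kernel_op (\<lambda>n m. localized_kernel P0 m n) h)"
  define x where "x = seq (kernel_op (\<lambda>n m. expanding_kernel W0 m n)
      (kernel_op (\<lambda>n m. localized_kernel P0 m n) h))"
  have green: "seq (even_green_adj h) k = x k / b k" for k
    by (simp add: even_green_adj_def seq_div_b x_def)
  have y_eq: "x k - \<theta> (k + 1) * x (k + 1) = y k" for k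
    unfolding x_def y_def using expanding_green_transpose[OF W0_expanding] by (simp add: \<theta>_def)
  have "y n - \<phi> (n + 1) * y (n + 1) = seq h n"
    unfolding y_def using localized_green_transpose[OF P0_localized assms] by (simp add: \<phi>_def)
  then have
    "x n - (\<theta> (n + 1) + \<phi> (n + 1)) * x (n + 1) + (\<theta> (n + 2) * \<phi> (n + 1)) * x (n + 2) = seq h n"
    unfolding y_eq[symmetric] by (simp add: algebra_simps)
  then show "seq (even_op_adj (even_green_adj h)) n = seq h n"
    using even_factorization(2)[of "n + 1", folded \<phi>_def \<theta>_def]
      even_factorization(1)[of "n + 2", folded \<phi>_def \<theta>_def]
    by (simp add: seq_even_op green add.commute[of 1 n])
qed

end

type_synonym sequence_triple = "sequence \<times> sequence \<times> sequence"

context interface_modes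
begin

text \<open>In the real form of the eigenvalue equation with the quasimomentum \<open>\<kappa> = k / 2\<close>, the two
  off-diagonal blocks act on the triples \<open>(f, p, q)\<close> and \<open>(P, Q, F)\<close>, where \<open>w\<^sub>4 = p + i f\<close>,
  \<open>w\<^sub>5 = q\<close>, \<open>w\<^sub>1 = P - i F\<close> and \<open>w\<^sub>2 = Q\<close>.\<close>

definition block_static :: "sequence_triple \<Rightarrow>\<^sub>L sequence_triple" where
  "block_static = Blinfun (\<lambda>(f, p, q). (mult_b (p + q), 2 *\<^sub>R mult_b p + hop_d_adj q, - mult_b f))"

definition block_cos :: "sequence_triple \<Rightarrow>\<^sub>L sequence_triple" where
  "block_cos = Blinfun (\<lambda>(f, p, q). (hop_c p, 0, hop_c f))"

definition block_sin :: "sequence_triple \<Rightarrow>\<^sub>L sequence_triple" where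
  "block_sin = Blinfun (\<lambda>(f, p, q). (- hop_c f, 0, hop_c p))"

definition block_adj_static :: "sequence_triple \<Rightarrow>\<^sub>L sequence_triple" where
  "block_adj_static = Blinfun (\<lambda>(P, Q, F). (- mult_b F, mult_b (P + Q), 2 *\<^sub>R mult_b P + hop_d Q))"

definition block_adj_cos :: "sequence_triple \<Rightarrow>\<^sub>L sequence_triple" where
  "block_adj_cos = Blinfun (\<lambda>(P, Q, F). (hop_c_adj F, hop_c_adj P, 0))"

definition block_adj_sin :: "sequence_triple \<Rightarrow>\<^sub>L sequence_triple" where
  "block_adj_sin = Blinfun (\<lambda>(P, Q, F). (- hop_c_adj P, hop_c_adj F, 0))"

definition block_green :: "sequence_triple \<Rightarrow>\<^sub>L sequence_triple" where
  "block_green = Blinfun (\<lambda>(hP, hQ, hF). let p = even_green_adj (hP - mult_b (hop_d_adj_inv hQ))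
     in (odd_green hF, p, hop_d_adj_inv (hQ - 2 *\<^sub>R mult_b p)))"

definition block_adj_green :: "sequence_triple \<Rightarrow>\<^sub>L sequence_triple" where
  "block_adj_green = Blinfun (\<lambda>(hf, hp, hq). let P = even_green (hp - mult_b (hop_d_inv hq))
     in (P, hop_d_inv (hq - 2 *\<^sub>R mult_b P), odd_green_adj hf))"

definition odd_functional :: "sequence_triple \<Rightarrow>\<^sub>L real" where
  "odd_functional = Blinfun (\<lambda>(f, p, q). pairing f0 f)"

definition even_functional :: "sequence_triple \<Rightarrow>\<^sub>L real" where
  "even_functional = Blinfun (\<lambda>(P, Q, F). pairing P0 (P - mult_b (hop_d_adj_inv Q)))"

lemma Blinfun_case_prod3_apply:
  assumes "bounded_linear (\<lambda>x. g (fst x) (fst (snd x)) (snd (snd x)))"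
  shows "Blinfun (\<lambda>(x, y, z). g x y z) (x, y, z) = g x y z"
  using bounded_linear_Blinfun_apply[OF assms] by (simp add: case_prod_unfold)

lemma block_apply [simp]:
  "block_static (f, p, q) = (mult_b (p + q), 2 *\<^sub>R mult_b p + hop_d_adj q, - mult_b f)"
  "block_cos (f, p, q) = (hop_c p, 0, hop_c f)"
  "block_sin (f, p, q) = (- hop_c f, 0, hop_c p)"
  "block_adj_static (P, Q, F) = (- mult_b F, mult_b (P + Q), 2 *\<^sub>R mult_b P + hop_d Q)"
  "block_adj_cos (P, Q, F) = (hop_c_adj F, hop_c_adj P, 0)"
  "block_adj_sin (P, Q, F) = (- hop_c_adj P, hop_c_adj F, 0)"
  unfolding block_static_def block_cos_def block_sin_def block_adj_static_def block_adj_cos_def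
    block_adj_sin_def
  by (subst Blinfun_case_prod3_apply; (intro bounded_linear_intros bounded_linear_minus)?; simp)+

lemma block_green_apply [simp]:
  "block_green (hP, hQ, hF) = (let p = even_green_adj (hP - mult_b (hop_d_adj_inv hQ))
     in (odd_green hF, p, hop_d_adj_inv (hQ - 2 *\<^sub>R mult_b p)))"
  "block_adj_green (hf, hp, hq) = (let P = even_green (hp - mult_b (hop_d_inv hq))
     in (P, hop_d_inv (hq - 2 *\<^sub>R mult_b P), odd_green_adj hf))"
  unfolding block_green_def block_adj_green_def Let_def
  by (subst Blinfun_case_prod3_apply; (intro bounded_linear_intros)?; simp)+

lemma functional_apply [simp]:
  "odd_functional (f, p, q) = pairing f0 f"
  "even_functional (P, Q, F) = pairing P0 (P - mult_b (hop_d_adj_inv Q))"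
  unfolding odd_functional_def even_functional_def
  by (subst Blinfun_case_prod3_apply; (intro bounded_linear_intros)?; simp)+

definition block :: "real \<Rightarrow> sequence_triple \<Rightarrow>\<^sub>L sequence_triple" where
  "block \<kappa> = block_static + cos \<kappa> *\<^sub>R block_cos + sin \<kappa> *\<^sub>R block_sin"

definition block_adj :: "real \<Rightarrow> sequence_triple \<Rightarrow>\<^sub>L sequence_triple" where
  "block_adj \<kappa> = block_adj_static + cos \<kappa> *\<^sub>R block_adj_cos + sin \<kappa> *\<^sub>R block_adj_sin"

lemma block_eq:
  "block \<kappa> (f, p, q) = (mult_b (p + q) + cos \<kappa> *\<^sub>R hop_c p - sin \<kappa> *\<^sub>R hop_c f,
     2 *\<^sub>R mult_b p + hop_d_adj q, cos \<kappa> *\<^sub>R hop_c f + sin \<kappa> *\<^sub>R hop_c p - mult_b f)"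
  "block_adj \<kappa> (P, Q, F) = (cos \<kappa> *\<^sub>R hop_c_adj F - sin \<kappa> *\<^sub>R hop_c_adj P - mult_b F,
     mult_b (P + Q) + cos \<kappa> *\<^sub>R hop_c_adj P + sin \<kappa> *\<^sub>R hop_c_adj F, 2 *\<^sub>R mult_b P + hop_d Q)"
  by (simp_all add: block_def block_adj_def blinfun.add_left blinfun.scaleR_left)

lemma block_green_right_inverse:
  assumes "even_functional h = 0"
  shows "(block_static + block_cos) (block_green h) = h"
proof -
  obtain hP hQ hF where h_eq: "h = (hP, hQ, hF)" by (cases h)
  define p where "p = even_green_adj (hP - mult_b (hop_d_adj_inv hQ))"
  have "even_op_adj p = hP - mult_b (hop_d_adj_inv hQ)"
    unfolding p_def using assms by (intro even_green_adj) (simp add: h_eq)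
  then have "mult_b (p + hop_d_adj_inv (hQ - 2 *\<^sub>R mult_b p)) + hop_c p = hP"
    by (simp add: even_op_adj_def blinfun.bilinear_simps algebra_simps)
  moreover have "hop_c (odd_green hF) - mult_b (odd_green hF) = hF" by (rule odd_green)
  ultimately show ?thesis by (simp add: h_eq Let_def p_def[symmetric] blinfun.add_left)
qed

lemma block_adj_green_right_inverse:
  assumes "odd_functional h = 0"
  shows "(block_adj_static + block_adj_cos) (block_adj_green h) = h"
proof -
  obtain hf hp hq where h_eq: "h = (hf, hp, hq)" by (cases h)
  define P where "P = even_green (hp - mult_b (hop_d_inv hq))"
  have "even_op P = hp - mult_b (hop_d_inv hq)" unfolding P_def by (rule even_green)
  then have "mult_b (P + hop_d_inv (hq - 2 *\<^sub>R mult_b P)) + hop_c_adj P = hp"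
    by (simp add: even_op_def blinfun.bilinear_simps algebra_simps)
  moreover have "hop_c_adj (odd_green_adj hf) - mult_b (odd_green_adj hf) = hf"
    using assms by (intro odd_green_adj) (simp add: h_eq)
  ultimately show ?thesis by (simp add: h_eq Let_def P_def[symmetric] blinfun.add_left)
qed

definition odd_mode :: sequence_triple where
  "odd_mode = (of_seq f0, 0, 0)"

definition even_mode :: sequence_triple where
  "even_mode = (of_seq P0, - 2 *\<^sub>R hop_d_inv (mult_b (of_seq P0)), 0)"

lemma seq_of_seq_modes [simp]: "seq (of_seq f0) = f0" "seq (of_seq P0) = P0"
  using localized_exp_bounded f0_localized P0_localized seq_of_seq by blast+

lemma odd_mode_kernel: "(block_static + block_cos) odd_mode = 0"
  using f0_zero_mode
  by (auto simp: odd_mode_def odd_zero_mode_def blinfun.add_left zero_prod_def intro!: seq_eqI)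

lemma even_mode_kernel: "(block_adj_static + block_adj_cos) even_mode = 0"
proof -
  have "even_op (of_seq P0) = 0"
    using P0_zero_mode by (intro seq_eqI) (simp add: seq_even_op even_zero_mode_def)
  then show ?thesis
    by (simp add: even_mode_def even_op_def blinfun.bilinear_simps zero_prod_def algebra_simps)
qed

text \<open>All pairings are sums of terms of one sign because the zero modes are positive.\<close>

lemma mode_pairings:
  "0 < odd_functional odd_mode" "0 < even_functional even_mode"
  "even_functional (block_sin odd_mode) < 0" "odd_functional (block_adj_sin even_mode) < 0"
proof -
  note pos = localized_pos[OF f0_localized] localized_pos[OF P0_localized] coeff_pos
  note pairing_f0 =
    pairing_pos[OF localized_exp_bounded[OF f0_localized] localized_pos[OF f0_localized]]
  note pairing_P0 =
    pairing_pos[OF localized_exp_bounded[OF P0_localized] localized_pos[OF P0_localized]]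
  show "0 < odd_functional odd_mode"
    unfolding odd_mode_def functional_apply by (rule pairing_f0) (simp add: pos)
  show "0 < even_functional even_mode"
    unfolding even_mode_def functional_apply
    by (rule pairing_P0) (simp add: pos add_pos_nonneg less_imp_le)
  have "0 < pairing P0 (hop_c (of_seq f0))" by (rule pairing_P0) (simp add: pos)
  then show "even_functional (block_sin odd_mode) < 0"
    by (simp add: odd_mode_def blinfun.bilinear_simps)
  have "0 < pairing f0 (hop_c_adj (of_seq P0))" by (rule pairing_f0) (simp add: pos)
  then show "odd_functional (block_adj_sin even_mode) < 0"
    by (simp add: even_mode_def blinfun.bilinear_simps)
qed

lemma block_eigenvalue_branch:
  obtains \<eta>0 R where "\<eta>0 \<noteq> 0"
    "\<forall>\<^sub>F \<kappa> in at 0. \<exists>\<eta> x y. block \<kappa> x = (\<kappa> * \<eta>) *\<^sub>R y \<and> block_adj \<kappa> y = (\<kappa> * \<eta>) *\<^sub>R x \<and>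
       \<bar>\<eta> - \<eta>0\<bar> \<le> R * \<bar>\<kappa>\<bar> \<and> norm (x - odd_mode) \<le> R * \<bar>\<kappa>\<bar>"
proof -
  have block:
    "(\<lambda>\<kappa>. norm (block \<kappa> - (block_static + block_cos) - \<kappa> *\<^sub>R block_sin)) \<in> O[at 0](\<lambda>\<kappa>. \<kappa>\<^sup>2)"
    unfolding block_def by (rule trigonometric_expansion)
  have block_adj: "(\<lambda>\<kappa>. norm (block_adj \<kappa> - (block_adj_static + block_adj_cos)
      - \<kappa> *\<^sub>R block_adj_sin)) \<in> O[at 0](\<lambda>\<kappa>. \<kappa>\<^sup>2)"
    unfolding block_adj_def by (rule trigonometric_expansion)
  have coupling:
    "0 < even_functional (block_sin odd_mode) * odd_functional (block_adj_sin even_mode)"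
    using mode_pairings by (intro mult_neg_neg)
  show ?thesis
    using chiral_double_zero_splitting[OF block block_adj odd_mode_kernel even_mode_kernel
        block_green_right_inverse block_adj_green_right_inverse mode_pairings(1,2) coupling] that
    by blast
qed

end

section \<open>Eigenvalues of the interface Hamiltonian\<close>

lemma atLeast1AtMost6_eq: "{1..6::nat} = {1, 2, 3, 4, 5, 6}"
  by auto

lemma is_eigenvalue_H_II_reflect:
  assumes "is_eigenvalue_H_II bp bm dp dm cc k E"
  shows "is_eigenvalue_H_II bm bp dm dp cc (- k) E"
proof -
  obtain w where eigenvector: "l2_C6 w" "\<exists>n. \<exists>j\<in>{1..6}. w n j \<noteq> 0"
    "\<And>n j. j \<in> {1..6} \<Longrightarrow> H_II bp bm dp dm cc k w n j = complex_of_real E * w n j"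
    using assms unfolding is_eigenvalue_H_II_def by blast
  define v where "v n j = w (- 1 - n) (7 - j)" for n j
  have coeffs: "coef_b bm bp n = coef_b bp bm (- 1 - n)"
    "coef_c bm bp dm dp cc n = coef_c bp bm dp dm cc (- n - 2)"
    "coef_d bm bp dm dp cc n = coef_d bp bm dp dm cc (- n - 3)" for n
    by (auto simp: coef_b_def coef_c_def coef_d_def)
  have "H_II bm bp dm dp cc (- k) v n j = H_II bp bm dp dm cc k w (- 1 - n) (7 - j)"
    if "j \<in> {1..6}" for n j
    using that unfolding atLeast1AtMost6_eq coeffs H_II_def Let_def v_def
    by (auto simp: algebra_simps)
  moreover have "7 - j \<in> {1..6}" if "j \<in> {1..6}" for j :: nat using that by auto
  ultimately have "H_II bm bp dm dp cc (- k) v n j = complex_of_real E * v n j"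
    if "j \<in> {1..6}" for n j
    using that eigenvector(3) by (simp add: v_def)
  moreover have "l2_C6 v"
  proof -
    have bij: "bij_betw (\<lambda>n::int. - 1 - n) UNIV UNIV"
      by (rule bij_betwI[of _ _ _ "\<lambda>n. - 1 - n"]) auto
    have "(\<Sum>j\<in>{1..6}. (cmod (v n j))\<^sup>2) = (\<Sum>j\<in>{1..6}. (cmod (w (- 1 - n) j))\<^sup>2)" for n
      unfolding atLeast1AtMost6_eq v_def by simp
    then show ?thesis
      using eigenvector(1)
        summable_on_reindex_bij_betw[OF bij, of "\<lambda>n. \<Sum>j\<in>{1..6}. (cmod (w n j))\<^sup>2"]
      unfolding l2_C6_def by simp
  qed
  moreover have "\<exists>n. \<exists>j\<in>{1..6}. v n j \<noteq> 0"
  proof -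
    obtain n j where "j \<in> {1..6}" "w n j \<noteq> 0" using eigenvector(2) by blast
    then have "7 - j \<in> {1..6}" "v (- 1 - n) (7 - j) \<noteq> 0" by (auto simp: v_def)
    then show ?thesis by blast
  qed
  ultimately show ?thesis unfolding is_eigenvalue_H_II_def by blast
qed

lemma is_eigenvalue_H_II_minus:
  assumes "is_eigenvalue_H_II bp bm dp dm cc k E"
  shows "is_eigenvalue_H_II bp bm dp dm cc k (- E)"
proof -
  obtain w where eigenvector: "l2_C6 w" "\<exists>n. \<exists>j\<in>{1..6}. w n j \<noteq> 0"
    "\<And>n j. j \<in> {1..6} \<Longrightarrow> H_II bp bm dp dm cc k w n j = complex_of_real E * w n j"
    using assms unfolding is_eigenvalue_H_II_def by blast
  define v where "v n j = (if j \<le> 3 then - w n j else w n j)" for n and j :: nat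
  have "H_II bp bm dp dm cc k v n j = (if j \<le> 3 then 1 else - 1) * H_II bp bm dp dm cc k w n j"
    if "j \<in> {1..6}" for n j
    using that unfolding atLeast1AtMost6_eq by (auto simp: H_II_def v_def Let_def)
  then have "\<forall>n. \<forall>j\<in>{1..6}. H_II bp bm dp dm cc k v n j = complex_of_real (- E) * v n j"
    using eigenvector(3) by (simp add: v_def)
  moreover have "cmod (v n j) = cmod (w n j)" for n j by (simp add: v_def)
  then have "l2_C6 v" using eigenvector(1) by (simp add: l2_C6_def)
  moreover have "\<exists>n. \<exists>j\<in>{1..6}. v n j \<noteq> 0" using eigenvector(2) by (auto simp: v_def)
  ultimately show ?thesis unfolding is_eigenvalue_H_II_def by blast
qed

lemma l2_C6_if_geometric_bound:
  assumes "0 \<le> r" "r < 1" and bound: "\<And>n j. j \<in> {1..6} \<Longrightarrow> cmod (w n j) \<le> C * r ^ nat \<bar>n\<bar>"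
  shows "l2_C6 w"
  unfolding l2_C6_def
proof (rule summable_on_if_geometric_bound[of "r\<^sup>2" _ "6 * C\<^sup>2"])
  show "r\<^sup>2 < 1" using assms by (simp add: power_less_one_iff)
  show "\<bar>\<Sum>j\<in>{1..6}. (cmod (w n j))\<^sup>2\<bar> \<le> 6 * C\<^sup>2 * (r\<^sup>2) ^ nat \<bar>n\<bar>" for n
  proof -
    have "(\<Sum>j\<in>{1..6::nat}. (cmod (w n j))\<^sup>2) \<le> of_nat (card {1..6::nat}) * (C * r ^ nat \<bar>n\<bar>)\<^sup>2"
      using bound by (intro sum_bounded_above power_mono) auto
    also have "(C * r ^ nat \<bar>n\<bar>)\<^sup>2 = C\<^sup>2 * (r\<^sup>2) ^ nat \<bar>n\<bar>"
      by (simp add: power_mult_distrib mult.commute flip: power_mult)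
    finally show ?thesis by (simp add: sum_nonneg)
  qed
qed simp

context interface
begin

text \<open>In the gauge \<open>e\<^bsup>i\<kappa>n\<^esup>\<close> with \<open>\<kappa> = k / 2\<close> the Hamiltonian commutes with complex conjugation
  composed with the exchange \<open>1 \<leftrightarrow> 3\<close>, \<open>4 \<leftrightarrow> 6\<close>. On vectors invariant under this symmetry the
  equations for the components 3 and 6 are redundant.\<close>

definition conj_symmetric_state ::
  "real \<Rightarrow> (int \<Rightarrow> complex) \<Rightarrow> (int \<Rightarrow> real) \<Rightarrow> (int \<Rightarrow> complex) \<Rightarrow> (int \<Rightarrow> real) \<Rightarrow> int \<Rightarrow> nat
      \<Rightarrow> complex" where
  "conj_symmetric_state \<kappa> u Q g q n j = cis \<kappa> powi n *
     (if j = 1 then u n else if j = 2 then of_real (Q n) else if j = 3 then cnj (u n)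
      else if j = 4 then g n else if j = 5 then of_real (q n) else cnj (g n))"

lemma H_II_conj_symmetric_state:
  fixes u g :: "int \<Rightarrow> complex" and Q q :: "int \<Rightarrow> real"
  assumes "j \<in> {1..6}"
  shows "H_II bp bm dp dm cc (2 * \<kappa>) (conj_symmetric_state \<kappa> u Q g q) n j = - (cis \<kappa> powi n) *
    (if j = 1 then b n * g n + b n * q n + c n * cis (- \<kappa>) * cnj (g (n + 1))
     else if j = 2 then b n * g n + d (n - 2) * q (n - 2) + b n * cnj (g n)
     else if j = 3 then c n * cis \<kappa> * g (n + 1) + b n * q n + b n * cnj (g n)
     else if j = 4 then b n * u n + b n * Q n + c (n - 1) * cis (- \<kappa>) * cnj (u (n - 1))
     else if j = 5 then b n * u n + d n * Q (n + 2) + b n * cnj (u n)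
     else c (n - 1) * cis \<kappa> * u (n - 1) + b n * Q n + b n * cnj (u n))"
proof -
  define z where "z = cis \<kappa>"
  have inverse_z: "z \<noteq> 0" "cis (- \<kappa>) = 1 / z"
    by (simp_all add: z_def divide_inverse cis_inverse)
  have coeffs: "coef_b bp bm n = of_real (b n)" "coef_c bp bm dp dm cc n = of_real (c n)"
    "coef_d bp bm dp dm cc n = of_real (d n)" for n
    by (simp_all add: coef_b_def coef_c_def coef_d_def b_def c_def d_def)
  have "z\<^sup>2 = exp (\<i> * complex_of_real (2 * \<kappa>))"
    using cis_conv_exp[of "2 * \<kappa>"] by (simp add: z_def Complex.DeMoivre)
  then have phases: "exp (\<i> * complex_of_real (2 * \<kappa>)) = z\<^sup>2"
    "exp (- \<i> * complex_of_real (2 * \<kappa>)) = 1 / z\<^sup>2"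
    by (simp_all add: exp_minus divide_inverse)
  show ?thesis
    using assms unfolding atLeast1AtMost6_eq H_II_def Let_def coeffs phases inverse_z(2)
      conj_symmetric_state_def z_def[symmetric]
    by (auto simp: inverse_z(1) power_int_add power_int_diff power2_eq_square field_simps)
qed

lemma is_eigenvalue_H_II_conj_symmetric:
  fixes u g :: "int \<Rightarrow> complex" and Q q :: "int \<Rightarrow> real"
  assumes r_bounds: "0 \<le> r" "r < 1"
    and bounds: "\<And>n. cmod (u n) \<le> C * r ^ nat \<bar>n\<bar>" "\<And>n. cmod (g n) \<le> C * r ^ nat \<bar>n\<bar>"
      "\<And>n. \<bar>Q n\<bar> \<le> C * r ^ nat \<bar>n\<bar>" "\<And>n. \<bar>q n\<bar> \<le> C * r ^ nat \<bar>n\<bar>"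
    and nonzero: "g m \<noteq> 0 \<or> q m \<noteq> 0"
    and row1: "\<And>n. b n * g n + b n * q n + c n * cis (- \<kappa>) * cnj (g (n + 1)) = E * u n"
    and row2: "\<And>n. b n * g n + d (n - 2) * q (n - 2) + b n * cnj (g n) = E * Q n"
    and row4: "\<And>n. b n * u n + b n * Q n + c (n - 1) * cis (- \<kappa>) * cnj (u (n - 1)) = E * g n"
    and row5: "\<And>n. b n * u n + d n * Q (n + 2) + b n * cnj (u n) = E * q n"
  shows "is_eigenvalue_H_II bp bm dp dm cc (2 * \<kappa>) (- E)"
proof -
  define w where "w = conj_symmetric_state \<kappa> u Q g q"
  have row3: "c n * cis \<kappa> * g (n + 1) + b n * q n + b n * cnj (g n) = E * cnj (u n)" for n
    using arg_cong[OF row1[of n], of cnj] by (simp add: cis_cnj algebra_simps)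
  have row6: "c (n - 1) * cis \<kappa> * u (n - 1) + b n * Q n + b n * cnj (u n) = E * cnj (g n)" for n
    using arg_cong[OF row4[of n], of cnj] by (simp add: cis_cnj algebra_simps)
  have "H_II bp bm dp dm cc (2 * \<kappa>) w n j = complex_of_real (- E) * w n j" if "j \<in> {1..6}" for n j
    unfolding w_def H_II_conj_symmetric_state[OF that] row1 row2 row3 row4 row5 row6
    using that by (auto simp: conj_symmetric_state_def)
  moreover have "\<exists>n. \<exists>j\<in>{1..6}. w n j \<noteq> 0"
  proof -
    have "w m 4 \<noteq> 0 \<or> w m 5 \<noteq> 0" using nonzero by (simp add: w_def conj_symmetric_state_def)
    moreover have "4 \<in> {1..6::nat}" "5 \<in> {1..6::nat}" by simp_all
    ultimately show ?thesis by blast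
  qed
  moreover have "l2_C6 w"
  proof (rule l2_C6_if_geometric_bound[OF r_bounds])
    have "cmod (cis \<kappa> powi n) = 1" for n by (simp add: norm_power_int)
    then show "cmod (w n j) \<le> C * r ^ nat \<bar>n\<bar>" for n j
      using bounds[of n] by (simp add: w_def conj_symmetric_state_def norm_mult)
  qed
  ultimately show ?thesis unfolding is_eigenvalue_H_II_def by blast
qed

end

lemma (in interface_modes) is_eigenvalue_H_II_block:
  assumes "block \<kappa> x = E *\<^sub>R y" "block_adj \<kappa> y = E *\<^sub>R x" "x \<noteq> 0"
  shows "is_eigenvalue_H_II bp bm dp dm cc (2 * \<kappa>) (- E)"
proof -
  obtain f p q where x_eq: "x = (f, p, q)" by (cases x)
  obtain P Q F where y_eq: "y = (P, Q, F)" by (cases y)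
  have rows: "mult_b (p + q) + cos \<kappa> *\<^sub>R hop_c p - sin \<kappa> *\<^sub>R hop_c f = E *\<^sub>R P"
    "2 *\<^sub>R mult_b p + hop_d_adj q = E *\<^sub>R Q"
    "cos \<kappa> *\<^sub>R hop_c f + sin \<kappa> *\<^sub>R hop_c p - mult_b f = E *\<^sub>R F"
    "cos \<kappa> *\<^sub>R hop_c_adj F - sin \<kappa> *\<^sub>R hop_c_adj P - mult_b F = E *\<^sub>R f"
    "mult_b (P + Q) + cos \<kappa> *\<^sub>R hop_c_adj P + sin \<kappa> *\<^sub>R hop_c_adj F = E *\<^sub>R p"
    "2 *\<^sub>R mult_b P + hop_d Q = E *\<^sub>R q"
    using assms(1,2) unfolding x_eq y_eq block_eq by simp_all
  have entry: "seq v n = seq v' n" if "v = v'" for v v' n using that by simp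
  have "f \<noteq> 0 \<or> p \<noteq> 0 \<or> q \<noteq> 0" using \<open>x \<noteq> 0\<close> by (simp add: x_eq zero_prod_def)
  then obtain m where nonzero: "seq f m \<noteq> 0 \<or> seq p m \<noteq> 0 \<or> seq q m \<noteq> 0" by (metis seq_nonzeroE)
  define B where "B = norm f + norm p + norm q + norm P + norm Q + norm F"
  have bound: "\<bar>seq v n\<bar> \<le> B * \<sigma> ^ nat \<bar>n\<bar>" if "norm v \<le> B" for v n
    using order_trans[OF abs_seq_le mult_right_mono[OF that]] \<sigma>_pos by simp
  have bounds: "\<bar>seq f n\<bar> \<le> B * \<sigma> ^ nat \<bar>n\<bar>" "\<bar>seq p n\<bar> \<le> B * \<sigma> ^ nat \<bar>n\<bar>"
    "\<bar>seq q n\<bar> \<le> B * \<sigma> ^ nat \<bar>n\<bar>"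
    "\<bar>seq P n\<bar> \<le> B * \<sigma> ^ nat \<bar>n\<bar>" "\<bar>seq Q n\<bar> \<le> B * \<sigma> ^ nat \<bar>n\<bar>" "\<bar>seq F n\<bar> \<le> B * \<sigma> ^ nat \<bar>n\<bar>" for n
    by (rule bound, simp add: B_def)+
  show ?thesis
  proof (rule is_eigenvalue_H_II_conj_symmetric[where u = "\<lambda>n. Complex (seq P n) (- seq F n)"
        and g = "\<lambda>n. Complex (seq p n) (seq f n)" and Q = "seq Q" and q = "seq q"
        and r = \<sigma> and C = "2 * B" and m = m])
    show "0 \<le> \<sigma>" "\<sigma> < 1" using \<sigma>_pos \<sigma>_less_1 by auto
    show "cmod (Complex (seq P n) (- seq F n)) \<le> 2 * B * \<sigma> ^ nat \<bar>n\<bar>"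
      "cmod (Complex (seq p n) (seq f n)) \<le> 2 * B * \<sigma> ^ nat \<bar>n\<bar>" for n
      using cmod_le[of "Complex (seq P n) (- seq F n)"]
        cmod_le[of "Complex (seq p n) (seq f n)"] bounds[of n]
      by simp_all
    show "\<bar>seq Q n\<bar> \<le> 2 * B * \<sigma> ^ nat \<bar>n\<bar>" "\<bar>seq q n\<bar> \<le> 2 * B * \<sigma> ^ nat \<bar>n\<bar>" for n
      unfolding mult.assoc using bounds[of n] by linarith+
    show "Complex (seq p m) (seq f m) \<noteq> 0 \<or> seq q m \<noteq> 0"
      using nonzero by (auto simp: complex_eq_iff)
  qed (use rows[THEN entry] in \<open>simp_all add: complex_eq_iff algebra_simps\<close>)
qed

definition has_linear_eigenvalue_branch :: "real \<Rightarrow> real \<Rightarrow> real \<Rightarrow> real \<Rightarrow> real \<Rightarrow> bool" where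
  "has_linear_eigenvalue_branch bp bm dp dm cc \<longleftrightarrow> (\<exists>E1 C. E1 \<noteq> 0 \<and>
     (\<forall>\<^sub>F k in at 0. \<exists>E. E \<noteq> 0 \<and> \<bar>E - E1 * \<bar>k\<bar>\<bar> \<le> C * k\<^sup>2 \<and> is_eigenvalue_H_II bp bm dp dm cc k E))"

lemma eventually_at_0_scale:
  fixes s :: real
  assumes "\<forall>\<^sub>F k in at 0. P k" "s \<noteq> 0"
  shows "\<forall>\<^sub>F k in at 0. P (s * k)"
proof (rule eventually_compose_filterlim[OF assms(1)])
  show "filterlim (\<lambda>k. s * k) (at 0) (at 0)"
    using assms(2) by (auto simp: filterlim_at eventually_at_filter intro!: tendsto_eq_intros)
qed

lemma (in interface_modes) modes_linear_eigenvalue_branch: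
  "has_linear_eigenvalue_branch bp bm dp dm cc"
proof -
  obtain \<eta>0 R where "\<eta>0 \<noteq> 0" and branch:
    "\<forall>\<^sub>F \<kappa> in at 0. \<exists>\<eta> x y. block \<kappa> x = (\<kappa> * \<eta>) *\<^sub>R y \<and> block_adj \<kappa> y = (\<kappa> * \<eta>) *\<^sub>R x \<and>
       \<bar>\<eta> - \<eta>0\<bar> \<le> R * \<bar>\<kappa>\<bar> \<and> norm (x - odd_mode) \<le> R * \<bar>\<kappa>\<bar>"
    by (rule block_eigenvalue_branch)
  have pos: "0 < \<bar>\<eta>0\<bar>" "0 < norm odd_mode" using \<open>\<eta>0 \<noteq> 0\<close> mode_pairings(1) by auto
  have "\<forall>\<^sub>F \<kappa> in at 0. \<exists>E. E \<noteq> 0 \<and> \<bar>E - \<eta>0 * \<bar>\<kappa>\<bar>\<bar> \<le> R * \<kappa>\<^sup>2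
      \<and> is_eigenvalue_H_II bp bm dp dm cc (2 * \<kappa>) E"
    using branch eventually_abs_mult_less[OF pos(1), of R] eventually_abs_mult_less[OF pos(2), of R]
      eventually_neq_at_within[of "0::real" 0 UNIV]
  proof eventually_elim
    case (elim \<kappa>)
    then obtain \<eta> x y where eigen: "block \<kappa> x = (\<kappa> * \<eta>) *\<^sub>R y" "block_adj \<kappa> y = (\<kappa> * \<eta>) *\<^sub>R x"
      and \<eta>_le: "\<bar>\<eta> - \<eta>0\<bar> \<le> R * \<bar>\<kappa>\<bar>" and x_le: "norm (x - odd_mode) \<le> R * \<bar>\<kappa>\<bar>" by blast
    have "x \<noteq> 0" using x_le elim by (auto simp: mult.commute)
    then have "is_eigenvalue_H_II bp bm dp dm cc (2 * \<kappa>) (- (\<kappa> * \<eta>))"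
      by (rule is_eigenvalue_H_II_block[OF eigen])
    then have "is_eigenvalue_H_II bp bm dp dm cc (2 * \<kappa>) (\<bar>\<kappa>\<bar> * \<eta>)"
      using is_eigenvalue_H_II_minus by (cases "0 < \<kappa>") force+
    moreover have "\<bar>\<kappa>\<bar> * \<eta> \<noteq> 0" using \<eta>_le elim by (auto simp: mult.commute)
    moreover have "\<bar>\<bar>\<kappa>\<bar> * \<eta> - \<eta>0 * \<bar>\<kappa>\<bar>\<bar> \<le> R * \<kappa>\<^sup>2"
    proof -
      have "\<bar>\<kappa>\<bar> * \<eta> - \<eta>0 * \<bar>\<kappa>\<bar> = \<bar>\<kappa>\<bar> * (\<eta> - \<eta>0)" by (simp add: algebra_simps)
      then have "\<bar>\<bar>\<kappa>\<bar> * \<eta> - \<eta>0 * \<bar>\<kappa>\<bar>\<bar> = \<bar>\<kappa>\<bar> * \<bar>\<eta> - \<eta>0\<bar>" by (simp add: abs_mult)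
      also have "\<dots> \<le> \<bar>\<kappa>\<bar> * (R * \<bar>\<kappa>\<bar>)" using \<eta>_le by (intro mult_left_mono) auto
      finally show ?thesis by (simp add: power2_eq_square mult_ac)
    qed
    ultimately show ?case by blast
  qed
  from eventually_at_0_scale[OF this, of "1 / 2"]
  show ?thesis
    unfolding has_linear_eigenvalue_branch_def using \<open>\<eta>0 \<noteq> 0\<close>
    by (intro exI[of _ "\<eta>0 / 2"] exI[of _ "R / 4"]) (simp add: abs_mult power_divide)
qed

lemma (in interface) interface_modes_exist:
  obtains \<sigma> f P W where "interface_modes bp bm dp dm cc \<sigma> f P W"
proof -
  obtain f where odd: "odd_zero_mode f" "two_sided_geometric (1 / rp) (1 / rm) f"
    by (rule odd_zero_mode_exists)
  obtain P where even: "even_zero_mode P" "two_sided_geometric (even_rate rp) (even_rate rm) P"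
    by (rule even_zero_mode_exists)
  obtain W where cofactor: "even_cofactor P W"
    "two_sided_geometric (even_rate rp + rp) (even_rate rm + rm) (\<lambda>n. \<bar>W n\<bar>)"
    by (rule even_cofactor_exists[OF even(2)])
  have rate_bounds: "0 < even_rate rp" "even_rate rp < 1" "1 < even_rate rm"
    using ratio_bounds even_rate_pos even_rate_less_1 even_rate_greater_1 by simp_all
  define rates where "rates = {1 / rp, rm, even_rate rp, 1 / even_rate rm,
      1 / (even_rate rp + rp), 1 / (even_rate rm + rm)}"
  have finite: "finite rates" "rates \<noteq> {}" by (simp_all add: rates_def)
  have "0 < x \<and> x < 1" if "x \<in> rates" for x
    using that ratio_bounds rate_bounds by (auto simp: rates_def)
  then have Max: "0 < Max rates" "Max rates < 1" using Max_in[OF finite] by blast+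
  then obtain \<sigma> where \<sigma>_bounds: "Max rates < \<sigma>" "\<sigma> < 1" using dense by blast
  have below: "x < \<sigma>" if "x \<in> rates" for x
    using Max_ge[OF finite(1) that] \<sigma>_bounds(1) by linarith
  have above: "1 / \<sigma> < y" if "1 / y \<in> rates" "0 < y" for y
    using below[OF that(1)] that(2) \<sigma>_bounds(1) Max(1) by (simp add: field_simps)
  interpret exponential_weight \<sigma> using \<sigma>_bounds Max(1) by unfold_locales auto
  have "localized f" "localized P" "expanding (\<lambda>n. \<bar>W n\<bar>)"
    unfolding localized_def expanding_def using odd(2) even(2) cofactor(2) ratio_bounds rate_bounds
    by (intro exI conjI below above; (assumption | simp add: rates_def))+
  then have "interface_modes bp bm dp dm cc \<sigma> f P W"
    using odd(1) even(1) cofactor(1) by unfold_locales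
  then show ?thesis by (rule that)
qed

lemma (in interface) linear_eigenvalue_branch: "has_linear_eigenvalue_branch bp bm dp dm cc"
proof -
  obtain \<sigma> f P W where "interface_modes bp bm dp dm cc \<sigma> f P W" by (rule interface_modes_exist)
  then interpret interface_modes bp bm dp dm cc \<sigma> f P W .
  show ?thesis by (rule modes_linear_eigenvalue_branch)
qed

lemma has_linear_eigenvalue_branch_reflect:
  assumes "has_linear_eigenvalue_branch bm bp dm dp cc"
  shows "has_linear_eigenvalue_branch bp bm dp dm cc"
proof -
  obtain E1 C where "E1 \<noteq> 0" and branch: "\<forall>\<^sub>F k in at 0. \<exists>E. E \<noteq> 0 \<and> \<bar>E - E1 * \<bar>k\<bar>\<bar> \<le> C * k\<^sup>2 \<and>
      is_eigenvalue_H_II bm bp dm dp cc k E"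
    using assms unfolding has_linear_eigenvalue_branch_def by blast
  have "\<forall>\<^sub>F k in at 0. \<exists>E. E \<noteq> 0 \<and> \<bar>E - E1 * \<bar>k\<bar>\<bar> \<le> C * k\<^sup>2 \<and> is_eigenvalue_H_II bp bm dp dm cc k E"
    using eventually_at_0_scale[OF branch, of "- 1", simplified]
  proof eventually_elim
    case (elim k)
    then show ?case using is_eigenvalue_H_II_reflect[of bm bp dm dp cc "- k"] by auto
  qed
  then show ?thesis unfolding has_linear_eigenvalue_branch_def using \<open>E1 \<noteq> 0\<close> by blast
qed

theorem theorem15:
  fixes bp bm dp dm cc :: real
  assumes "bp > 0" and "bm > 0" and "bp + dp > 0" and "bm + dm > 0"
    and "dp * dm < 0" and "cc > 0"
  shows "\<exists>E1::real. E1 \<noteq> 0 \<and>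
    (\<exists>\<epsilon>>0. \<exists>C. \<exists>Ep Em :: real \<Rightarrow> real. \<forall>k. 0 < \<bar>k\<bar> \<and> \<bar>k\<bar> < \<epsilon> \<longrightarrow>
       Ep k \<noteq> Em k \<and>
       is_eigenvalue_H_II bp bm dp dm cc k (Ep k) \<and>
       is_eigenvalue_H_II bp bm dp dm cc k (Em k) \<and>
       \<bar>Ep k - E1 * \<bar>k\<bar>\<bar> \<le> C * k\<^sup>2 \<and>
       \<bar>Em k + E1 * \<bar>k\<bar>\<bar> \<le> C * k\<^sup>2)"
proof -
  consider (pos_neg) "0 < dp" "dm < 0" | (neg_pos) "dp < 0" "0 < dm" using assms(5) by (auto simp: mult_less_0_iff)
  then have "has_linear_eigenvalue_branch bp bm dp dm cc"
  proof cases
    case pos_neg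
    then interpret interface bp bm dp dm cc using assms by unfold_locales
    show ?thesis by (rule linear_eigenvalue_branch)
  next
    case neg_pos
    then interpret interface bm bp dm dp cc using assms by unfold_locales
    show ?thesis by (rule has_linear_eigenvalue_branch_reflect[OF linear_eigenvalue_branch])
  qed
  then obtain E1 C \<epsilon> where "E1 \<noteq> 0" "0 < \<epsilon>" and
    "\<And>k. 0 < \<bar>k\<bar> \<and> \<bar>k\<bar> < \<epsilon> \<Longrightarrow> \<exists>E. E \<noteq> 0 \<and> \<bar>E - E1 * \<bar>k\<bar>\<bar> \<le> C * k\<^sup>2
        \<and> is_eigenvalue_H_II bp bm dp dm cc k E"
    unfolding has_linear_eigenvalue_branch_def eventually_at by (auto simp: dist_real_def)
  then obtain E where "\<And>k. 0 < \<bar>k\<bar> \<and> \<bar>k\<bar> < \<epsilon> \<Longrightarrow>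
      E k \<noteq> 0 \<and> \<bar>E k - E1 * \<bar>k\<bar>\<bar> \<le> C * k\<^sup>2 \<and> is_eigenvalue_H_II bp bm dp dm cc k (E k)"
    by metis
  then show ?thesis using \<open>E1 \<noteq> 0\<close> \<open>0 < \<epsilon>\<close> is_eigenvalue_H_II_minus
    by (intro exI[of _ E1] conjI exI[of _ \<epsilon>] exI[of _ C] exI[of _ E] exI[of _ "\<lambda>k. - E k"])
      (auto simp: abs_minus_commute)
qed

end
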